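(* Let $(X,T)$ be an essentially minimal system of finite topological rank on a compact totally disconnected metrizable space $X$. Then every minimal Cantor factor $(Y,S)$ of $(X,T)$ is an odometer or a subshift (up to topological conjugacy).
   Context: A topological dynamical system is a pair $(X,T)$ with $X$ a (nonempty) compact metric space and $T:X\to X$ a homeomorphism. A subsystem is a nonempty closed invariant subset $Z$ with the restriction of $T$. The system is minimal if every orbit $\{T^n x\}_{n\in\mathbb Z}$ is dense, and essentially minimal if it has a unique minimal subsystem. A Cantor space is a nonempty compact metrizable totally disconnected space without isolated points. $(Y,S)$ is a factor of $(X,T)$ if there is a continuous map $\alpha:X\to Y$ with $\alpha\circ T=S\circ\alpha$; it is a minimal Cantor factor if moreover $Y$ is a Cantor space and $(Y,S)$ is minimal. An odometer is a minimal isometry on a Cantor set (for some compatible metric). A subshift is a subsystem of the shift map on $A^{\mathbb Z}$, where $A$ is a finite alphabet with at least two letters and $A^{\mathbb Z}$ has the product topology. Topological rank. Let $X$ be a compact totally disconnected metrizable space and $(X,T)$ essentially minimal. A Kakutani-Rokhlin partition is a finite partition of $X$ into nonempty clopen sets of the form $\{T^{j}B_{i} : 1\le i\le k,\ 0\le j<h_i\}$; for each $i$ the family $\{T^jB_i:0\le j<h_i\}$ is called a tower, and $\bigcup_{i=1}^k B_i$ is the base. A realization of $(X,T)$ is a sequence $(\mathcal T_n)_{n\ge1}$ of Kakutani-Rokhlin partitions such that $\mathcal T_{n+1}$ refines $\mathcal T_n$, the base of $\mathcal T_{n+1}$ is contained in the base of $\mathcal T_n$, the intersection of all the bases is a single point,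 and $\bigcup_n\mathcal T_n$ generates the topology of $X$. The system has finite topological rank if it has a realization in which the number of towers of $\mathcal T_n$ is bounded uniformly in $n$. *)

theory Defs
  imports "HOL-Analysis.Analysis"
begin

text \<open>
  A system consists of an abstract topology \<open>X\<close> (the compact metrizable space, with underlying set
  \<open>topspace X\<close>) and a map \<open>T\<close>, of which only the values on \<open>topspace X\<close> matter.
\<close>

definition dynamical_system :: "'a topology \<Rightarrow> ('a \<Rightarrow> 'a) \<Rightarrow> bool" where
  "dynamical_system X T \<longleftrightarrow>
     topspace X \<noteq> {} \<and> compact_space X \<and> metrizable_space X \<and> homeomorphic_map X X T"

definition int_iterate :: "'a topology \<Rightarrow> ('a \<Rightarrow> 'a) \<Rightarrow> int \<Rightarrow> 'a \<Rightarrow> 'a" where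
  "int_iterate X T n =
     (if n \<ge> 0 then T ^^ nat n else inv_into (topspace X) T ^^ nat (- n))"

definition orbit_of :: "'a topology \<Rightarrow> ('a \<Rightarrow> 'a) \<Rightarrow> 'a \<Rightarrow> 'a set" where
  "orbit_of X T x = range (\<lambda>n. int_iterate X T n x)"

definition minimal_system :: "'a topology \<Rightarrow> ('a \<Rightarrow> 'a) \<Rightarrow> bool" where
  "minimal_system X T \<longleftrightarrow>
     dynamical_system X T \<and> (\<forall>x\<in>topspace X. X closure_of orbit_of X T x = topspace X)"

text \<open>
  Invariance means \<open>T ` Z = Z\<close>, so that \<open>T\<close> restricts to a homeomorphism of \<open>Z\<close>.
\<close>

definition subsystem :: "'a topology \<Rightarrow> ('a \<Rightarrow> 'a) \<Rightarrow> 'a set \<Rightarrow> bool" where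
  "subsystem X T Z \<longleftrightarrow> Z \<noteq> {} \<and> closedin X Z \<and> T ` Z = Z"

definition essentially_minimal :: "'a topology \<Rightarrow> ('a \<Rightarrow> 'a) \<Rightarrow> bool" where
  "essentially_minimal X T \<longleftrightarrow>
     dynamical_system X T \<and> (\<exists>!Z. subsystem X T Z \<and> minimal_system (subtopology X Z) T)"

definition totally_disconnected_space :: "'a topology \<Rightarrow> bool" where
  "totally_disconnected_space X \<longleftrightarrow> (\<forall>C. connectedin X C \<longrightarrow> (\<exists>a. C \<subseteq> {a}))"

definition cantor_space :: "'a topology \<Rightarrow> bool" where
  "cantor_space X \<longleftrightarrow>
     topspace X \<noteq> {} \<and> compact_space X \<and> metrizable_space X \<and> totally_disconnected_space X \<and>
     (\<forall>x\<in>topspace X. \<not> openin X {x})"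

definition factor_system ::
  "'a topology \<Rightarrow> ('a \<Rightarrow> 'a) \<Rightarrow> 'b topology \<Rightarrow> ('b \<Rightarrow> 'b) \<Rightarrow> bool" where
  "factor_system X T Y S \<longleftrightarrow>
     dynamical_system X T \<and> dynamical_system Y S \<and>
     (\<exists>\<alpha>. continuous_map X Y \<alpha> \<and> (\<forall>x\<in>topspace X. \<alpha> (T x) = S (\<alpha> x)))"

definition minimal_cantor_factor ::
  "'a topology \<Rightarrow> ('a \<Rightarrow> 'a) \<Rightarrow> 'b topology \<Rightarrow> ('b \<Rightarrow> 'b) \<Rightarrow> bool" where
  "minimal_cantor_factor X T Y S \<longleftrightarrow>
     factor_system X T Y S \<and> cantor_space Y \<and> minimal_system Y S"

definition conjugate_systems ::
  "'a topology \<Rightarrow> ('a \<Rightarrow> 'a) \<Rightarrow> 'b topology \<Rightarrow> ('b \<Rightarrow> 'b) \<Rightarrow> bool" where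
  "conjugate_systems X T Y S \<longleftrightarrow>
     (\<exists>\<phi>. homeomorphic_map X Y \<phi> \<and> (\<forall>x\<in>topspace X. \<phi> (T x) = S (\<phi> x)))"

definition odometer :: "'a topology \<Rightarrow> ('a \<Rightarrow> 'a) \<Rightarrow> bool" where
  "odometer X T \<longleftrightarrow>
     cantor_space X \<and> minimal_system X T \<and>
     (\<exists>d. Metric_space (topspace X) d \<and> Metric_space.mtopology (topspace X) d = X \<and>
          (\<forall>x\<in>topspace X. \<forall>y\<in>topspace X. d (T x) (T y) = d x y))"

definition full_shift :: "'c set \<Rightarrow> (int \<Rightarrow> 'c) topology" where
  "full_shift A = product_topology (\<lambda>_. discrete_topology A) UNIV"

definition shift_map :: "(int \<Rightarrow> 'c) \<Rightarrow> int \<Rightarrow> 'c" where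
  "shift_map x = (\<lambda>n. x (n + 1))"

definition subshift :: "'c set \<Rightarrow> (int \<Rightarrow> 'c) set \<Rightarrow> bool" where
  "subshift A Z \<longleftrightarrow> finite A \<and> card A \<ge> 2 \<and> subsystem (full_shift A) shift_map Z"

text \<open>
  A Kakutani-Rokhlin partition is given by the number \<open>k\<close> of its towers and, for \<open>i < k\<close>, the base
  \<open>B i\<close> and the height \<open>h i\<close> of the \<open>i\<close>-th tower; towers are numbered from 0, and values at
  \<open>i \<ge> k\<close> are irrelevant.  Disjointness is required of the indexed family, i.e. distinct pairs
  \<open>(i, j)\<close> give disjoint levels.
\<close>

definition kr_levels :: "('a \<Rightarrow> 'a) \<Rightarrow> nat \<Rightarrow> (nat \<Rightarrow> 'a set) \<Rightarrow> (nat \<Rightarrow> nat) \<Rightarrow> 'a set set" where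
  "kr_levels T k B h = {(T ^^ j) ` B i |i j. i < k \<and> j < h i}"

definition kr_base :: "nat \<Rightarrow> (nat \<Rightarrow> 'a set) \<Rightarrow> 'a set" where
  "kr_base k B = (\<Union>i<k. B i)"

definition kr_partition ::
  "'a topology \<Rightarrow> ('a \<Rightarrow> 'a) \<Rightarrow> nat \<Rightarrow> (nat \<Rightarrow> 'a set) \<Rightarrow> (nat \<Rightarrow> nat) \<Rightarrow> bool" where
  "kr_partition X T k B h \<longleftrightarrow>
     (\<forall>i<k. h i \<ge> 1) \<and>
     (\<forall>U\<in>kr_levels T k B h. U \<noteq> {} \<and> openin X U \<and> closedin X U) \<and>
     disjoint_family_on (\<lambda>(i, j). (T ^^ j) ` B i) (SIGMA i:{..<k}. {..<h i}) \<and>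
     \<Union> (kr_levels T k B h) = topspace X"

definition kr_realization ::
  "'a topology \<Rightarrow> ('a \<Rightarrow> 'a) \<Rightarrow>
   (nat \<Rightarrow> nat) \<Rightarrow> (nat \<Rightarrow> nat \<Rightarrow> 'a set) \<Rightarrow> (nat \<Rightarrow> nat \<Rightarrow> nat) \<Rightarrow> bool" where
  "kr_realization X T k B h \<longleftrightarrow>
     (\<forall>n. kr_partition X T (k n) (B n) (h n)) \<and>
     (\<forall>n. \<forall>U\<in>kr_levels T (k (Suc n)) (B (Suc n)) (h (Suc n)).
            \<exists>V\<in>kr_levels T (k n) (B n) (h n). U \<subseteq> V) \<and>
     (\<forall>n. kr_base (k (Suc n)) (B (Suc n)) \<subseteq> kr_base (k n) (B n)) \<and>
     (\<exists>x. (\<Inter>n. kr_base (k n) (B n)) = {x}) \<and>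
     topology_generated_by (\<Union>n. kr_levels T (k n) (B n) (h n)) = X"

definition finite_topological_rank :: "'a topology \<Rightarrow> ('a \<Rightarrow> 'a) \<Rightarrow> bool" where
  "finite_topological_rank X T \<longleftrightarrow>
     (\<exists>k B h. kr_realization X T k B h \<and> (\<exists>K. \<forall>n. k n \<le> K))"

end

(*
  Code Y by the itineraries of finitely many clopen sets G 0, ..., G (m - 1) of a sequence of clopen
  sets that separates points.  If for some m the code determines the point, Y is a subshift; if every
  code is periodic, the codes define an invariant ultrametric and Y is an odometer.  So suppose that
  the m0-codes are aperiodic while no m-code is injective.

  Every point of X is cut at its visits to the base of the n-th partition, and its code becomes a
  concatenation of at most K tower words.  If many points of X have the same m0-code but pairwise no
  common cut, then around every position of that code some tower word overlaps itself many times;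
  such a sequence is locally periodic with at most K periods and hence periodic.  So the number of
  such points is bounded.  Taking a maximal family, one finds for large m and every m' > m with
  different fibres two points of X with equal m-codes, distinct m'-codes and a common cut.  The
  defect theorem, applied to the m-code read from this cut, shows that the tower words of the m-code
  are products of fewer words than those of the m'-code.  Iterating this more than K times is
  impossible.
*)

theory Submission
  imports Defs
begin

section \<open>Locally periodic sequences\<close>

text \<open>Two points with equal \<open>m\<close>-codes and distinct \<open>m'\<close>-codes need
  not have a common cut, and the defect theorem needs two parses that start at the same place.
  Families without common cuts remove this obstacle. The bound \<open>L\<close> on their size
  depends on \<open>K\<close> alone, once \<open>m0\<close> excludes periodic codes; so some size
  \<open>q\<close> occurs at every coding level \<open>m \<ge> m0\<close> while \<open>q + 1\<close>
  does not occur from a level \<open>m1\<close> on. Let \<open>y\<close> and \<open>y'\<close> have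
  equal \<open>m\<close>-codes and distinct \<open>m'\<close>-codes. By minimality a family of
  \<open>q\<close> points with a common \<open>m'\<close>-code can be found over \<open>y\<close>. A
  preimage of \<open>y'\<close> has the \<open>m\<close>-code of this family and cannot enlarge it,
  so it shares a cut with a member, whose \<open>m'\<close>-code is that of \<open>y\<close>. The
  quantity that drops is the number of words needed to generate the tower words, not the number of
  tower words, because the defect theorem replaces words by pieces of them. For fixed
  \<open>m\<close> it is at most \<open>K\<close> for all large \<open>n\<close>, while each
  refinement of the code raises its lower bound by one.\<close>

definition run :: "(int \<Rightarrow> 'c) \<Rightarrow> int \<Rightarrow> int \<Rightarrow> int \<Rightarrow> bool" where
  "run z p a b \<longleftrightarrow> (\<forall>t. a \<le> t \<and> t + p \<le> b \<longrightarrow> z t = z (t + p))"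

lemma runD: "run z p a b \<Longrightarrow> a \<le> t \<Longrightarrow> t + p \<le> b \<Longrightarrow> z t = z (t + p)"
  by (simp add: run_def)

text \<open>Walk from \<open>e\<close> towards \<open>b0\<close> and stop at the first break. Since
  \<open>r \<ge> 2\<close>, the given run keeps it more than \<open>p\<close> away from
  \<open>e\<close>, so \<open>p\<close> consecutive positions just before it are free of breaks. The
  last two alternatives belong to the two directions of the walk.\<close>

lemma nearest_break:
  fixes z :: "int \<Rightarrow> 'c"
  assumes run: "run z p (e - r * p) (e + r * p)" and p: "p > 0" and r: "r \<ge> 2"
    and b0: "z b0 \<noteq> z (b0 + p)"
  obtains b where "z b \<noteq> z (b + p)" "min e b0 \<le> b" "b \<le> max e b0"
    "run z p (b - p) (b - 1 + p) \<or> run z p (b + 1) (b + 2 * p)"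
proof -
  have rp: "r * p \<ge> 2 * p" using p r by simp
  show ?thesis
  proof (cases "e \<le> b0")
    case True
    let ?A = "{b \<in> {e..b0}. z b \<noteq> z (b + p)}"
    have fin: "finite ?A" by (rule finite_subset[of _ "{e..b0}"]) auto
    have ne: "?A \<noteq> {}" using True b0 by auto
    define b where "b = Min ?A"
    have b: "b \<in> ?A" unfolding b_def by (rule Min_in[OF fin ne])
    have least: "z t = z (t + p)" if "e \<le> t" "t < b" for t
    proof (rule ccontr)
      assume "z t \<noteq> z (t + p)"
      with that b have "t \<in> ?A" by auto
      then have "b \<le> t" unfolding b_def by (rule Min_le[OF fin])
      with that show False by simp
    qed
    have "\<not> b + p \<le> e + r * p" using runD[OF run, of b] b rp p by auto
    then have "e + p \<le> b" using rp by linarith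
    then have "run z p (b - p) (b - 1 + p)"
      unfolding run_def by (intro allI impI least) auto
    then show ?thesis using b True by (intro that[of b]) auto
  next
    case False
    let ?A = "{b \<in> {b0..e}. z b \<noteq> z (b + p)}"
    have fin: "finite ?A" by (rule finite_subset[of _ "{b0..e}"]) auto
    have "b0 \<in> ?A" using False b0 by simp
    then have ne: "?A \<noteq> {}" by blast
    define b where "b = Max ?A"
    have b: "b \<in> ?A" unfolding b_def by (rule Max_in[OF fin ne])
    have greatest: "z t = z (t + p)" if "t \<le> e" "b < t" for t
    proof (rule ccontr)
      assume "z t \<noteq> z (t + p)"
      with that b have "t \<in> ?A" by auto
      then have "t \<le> b" unfolding b_def by (rule Max_ge[OF fin])
      with that show False by simp
    qed
    have "\<not> e - r * p \<le> b"
    proof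
      assume le: "e - r * p \<le> b"
      have "b \<le> e" using b by simp
      then have "b + p \<le> e + r * p" using rp p by linarith
      then show False using runD[OF run le] b by auto
    qed
    then have "b + 2 * p \<le> e" using rp by linarith
    then have "run z p (b + 1) (b + 2 * p)"
      unfolding run_def using p by (intro allI impI greatest) auto
    then show ?thesis using b False by (intro that[of b]) auto
  qed
qed

text \<open>
  At an edge \<open>f\<close> of a run of period \<open>P\<close>, a run of a smaller period \<open>p\<close> must also break within distance
  \<open>P\<close>, for otherwise the break at \<open>f\<close> could be transported by \<open>p\<close> into the run of period \<open>P\<close>.  Applying
  the induction hypothesis at that break increases \<open>p\<close>, until it exceeds \<open>P\<close>.
\<close>

lemma longer_period_near_edge:
  fixes z :: "int \<Rightarrow> 'c"
  assumes fin: "finite S" and pos: "\<And>p. p \<in> S \<Longrightarrow> p > 0"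
    and r: "r = 2 ^ card S + 1"
    and cover: "\<And>e. \<exists>p\<in>S. run z p (e - r * p) (e + r * p)"
  shows "P \<in> S \<Longrightarrow> z f \<noteq> z (f + P) \<Longrightarrow>
    run z P (f - P) (f - 1 + P) \<or> run z P (f + 1) (f + 2 * P) \<Longrightarrow>
    \<exists>e p. p \<in> S \<and> P < p \<and> \<bar>e - f\<bar> \<le> P * 2 ^ card {q\<in>S. q < P} \<and> run z p (e - r * p) (e + r * p)"
proof (induction "nat P" arbitrary: P f rule: less_induct)
  case less
  \<comment> \<open>Each round of the search at most doubles the distance to \<open>f\<close> and
    moves to a longer period, which raises \<open>N\<close>; hence the bounds
    \<open>P * 2 ^ N p\<close>.\<close>
  define N where "N = (\<lambda>p. card {q\<in>S. q < p})"
  have Nless: "N p + 1 \<le> N p'" if "p \<in> S" "p < p'" for p p'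
  proof -
    have "{q\<in>S. q < p} \<subset> {q\<in>S. q < p'}" using that by auto
    then have "N p < N p'" unfolding N_def using fin by (intro psubset_card_mono) auto
    then show ?thesis by simp
  qed
  have N_le: "N p \<le> card S" for p unfolding N_def using fin by (intro card_mono) auto
  have P: "P > 0" using pos less.prems(1) .
  have r2: "r \<ge> 2" unfolding r by simp
  \<comment> \<open>This fixes \<open>r\<close>: a run of period \<open>P\<close> centred this close
    to \<open>f\<close> contains both \<open>f\<close> and \<open>f + P\<close>, because
    \<open>r * P - P = P * 2 ^ card S\<close>.\<close>
  have not_P: "\<not> run z P (e - r * P) (e + r * P)" if "\<bar>e - f\<bar> \<le> P * 2 ^ N P" for e
  proof
    assume *: "run z P (e - r * P) (e + r * P)"
    have "P * 2 ^ N P \<le> P * 2 ^ card S" using P N_le by (simp add: power_increasing)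
    then have "\<bar>e - f\<bar> \<le> r * P - P" using that unfolding r by (simp add: algebra_simps)
    then have "z f = z (f + P)" using P by (intro runD[OF *]) auto
    then show False using less.prems(2) by simp
  qed
  show ?case
  proof (rule ccontr)
    assume "\<not> ?case"
    then have contra: "p \<le> P" if "p \<in> S" "\<bar>e - f\<bar> \<le> P * 2 ^ N P" "run z p (e - r * p) (e + r * p)" for e p
      using that unfolding N_def by force
    \<comment> \<open>The periods below \<open>P\<close> that are met within their own bound. The
      largest of them will yield a longer one, which \<open>contra\<close> and \<open>not_P\<close>
      force back into \<open>Q\<close>.\<close>
    define Q where "Q = {p\<in>S. p < P \<and> (\<exists>e. \<bar>e - f\<bar> \<le> P * 2 ^ N p \<and> run z p (e - r * p) (e + r * p))}"
    have finQ: "finite Q" unfolding Q_def using fin by auto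
    obtain p0 where p0: "p0 \<in> S" "run z p0 (f - r * p0) (f + r * p0)" using cover by blast
    have "p0 \<le> P" using contra[OF p0(1), of f] p0(2) P by simp
    moreover have "p0 \<noteq> P" using not_P[of f] p0 P by auto
    ultimately have "p0 \<in> Q" unfolding Q_def using p0 P by (auto intro!: exI[of _ f])
    then have neQ: "Q \<noteq> {}" by auto
    define p where "p = Max Q"
    have "p \<in> Q" unfolding p_def using finQ neQ by (rule Max_in)
    then obtain e where e: "p \<in> S" "p < P" "\<bar>e - f\<bar> \<le> P * 2 ^ N p" "run z p (e - r * p) (e + r * p)"
      unfolding Q_def by auto
    have p: "p > 0" using pos e by auto
    \<comment> \<open>Take \<open>x = f - p\<close> or \<open>x = f\<close>. Of the steps of length
      \<open>P\<close> from \<open>x\<close> and \<open>x + p\<close>, one preserves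
      \<open>z\<close> and the other does not; so the steps of length \<open>p\<close> from
      \<open>x\<close> and \<open>x + P\<close> cannot both preserve it.\<close>
    have "\<exists>b0. \<bar>b0 - f\<bar> \<le> P \<and> z b0 \<noteq> z (b0 + p)"
      using less.prems(3)
    proof
      assume *: "run z P (f - P) (f - 1 + P)"
      have eq: "z (f - p) = z (f - p + P)" using e p by (intro runD[OF *]) auto
      show ?thesis
      proof (cases "z (f - p) = z f")
        case True
        then have "z (f + P - p) \<noteq> z (f + P - p + p)" using eq less.prems(2) by (simp add: algebra_simps)
        then show ?thesis using e p by (intro exI[of _ "f + P - p"]) auto
      next
        case False
        then show ?thesis using e p by (intro exI[of _ "f - p"]) auto
      qed
    next
      assume *: "run z P (f + 1) (f + 2 * P)"
      have eq: "z (f + p) = z (f + p + P)" using e p by (intro runD[OF *]) auto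
      show ?thesis
      proof (cases "z f = z (f + p)")
        case True
        then have "z (f + P) \<noteq> z (f + P + p)" using eq less.prems(2) by (simp add: algebra_simps)
        then show ?thesis using P by (intro exI[of _ "f + P"]) auto
      next
        case False
        then show ?thesis using P by (intro exI[of _ f]) auto
      qed
    qed
    then obtain b0 where b0: "\<bar>b0 - f\<bar> \<le> P" "z b0 \<noteq> z (b0 + p)" by blast
    obtain b where b: "z b \<noteq> z (b + p)" "min e b0 \<le> b" "b \<le> max e b0"
      "run z p (b - p) (b - 1 + p) \<or> run z p (b + 1) (b + 2 * p)"
      using nearest_break[OF e(4) p r2 b0(2)] .
    have pow: "P \<le> P * 2 ^ N p" using P by simp
    have bf: "\<bar>b - f\<bar> \<le> P * 2 ^ N p" using b(2,3) b0(1) e(3) pow by linarith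
    obtain e' p' where e': "p' \<in> S" "p < p'" "\<bar>e' - b\<bar> \<le> p * 2 ^ N p" "run z p' (e' - r * p') (e' + r * p')"
    proof -
      have "nat p < nat P" using e(2) p by simp
      from less.hyps[OF this e(1) b(1,4)] show ?thesis using that unfolding N_def by blast
    qed
    \<comment> \<open>The ways from \<open>f\<close> to \<open>b\<close> and from \<open>b\<close>
      to \<open>e'\<close> are both at most \<open>P * 2 ^ N p\<close>; the factor 2 is absorbed by
      \<open>N p + 1 \<le> N p'\<close>.\<close>
    have "p * 2 ^ N p \<le> P * 2 ^ N p" using e(2) by simp
    then have "\<bar>e' - f\<bar> \<le> 2 * (P * 2 ^ N p)" using bf e'(3) by linarith
    then have "\<bar>e' - f\<bar> \<le> P * 2 ^ (N p + 1)" by (simp add: algebra_simps)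
    moreover have mono: "P * 2 ^ (N p + 1) \<le> P * 2 ^ N x" if "p < x" for x
      using P Nless[OF e(1) that] power_increasing[of "N p + 1" "N x" "2::int"] by simp
    ultimately have e'f: "\<bar>e' - f\<bar> \<le> P * 2 ^ N x" if "p < x" for x using that by force
    have "p' \<le> P" using contra[OF e'(1) _ e'(4)] e'f[OF e(2)] by simp
    moreover have "p' \<noteq> P" using not_P[of e'] e'f[OF e(2)] e'(4) by auto
    ultimately have "p' \<in> Q" unfolding Q_def using e' e'f[OF e'(2)] by auto
    then have "p' \<le> p" unfolding p_def using finQ by simp
    then show False using e' by simp
  qed
qed

text \<open>The largest period that has a run of the required radius anywhere is global: a break of
  it, taken nearest to that run, would produce a run of a still longer period from
  \<open>S\<close>.\<close>

lemma locally_periodic_imp_periodic: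
  fixes z :: "int \<Rightarrow> 'c"
  assumes fin: "finite S" and pos: "\<And>p. p \<in> S \<Longrightarrow> p > 0"
    and r: "r = 2 ^ card S + 1"
    and cover: "\<And>e. \<exists>p\<in>S. run z p (e - r * p) (e + r * p)"
  shows "\<exists>p\<in>S. \<forall>t. z t = z (t + p)"
proof (rule ccontr)
  assume "\<not> ?thesis"
  then have break: "\<exists>t. z t \<noteq> z (t + p)" if "p \<in> S" for p using that by blast
  define Q where "Q = {p\<in>S. \<exists>e. run z p (e - r * p) (e + r * p)}"
  have finQ: "finite Q" unfolding Q_def using fin by auto
  have "Q \<noteq> {}" unfolding Q_def using cover[of 0] by blast
  then have "Max Q \<in> Q" using finQ by simp
  then obtain p e where p: "p = Max Q" "p \<in> S" "run z p (e - r * p) (e + r * p)"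
    unfolding Q_def by auto
  obtain b0 where b0: "z b0 \<noteq> z (b0 + p)" using break p by blast
  have r2: "r \<ge> 2" unfolding r by simp
  obtain b where b: "z b \<noteq> z (b + p)"
      "run z p (b - p) (b - 1 + p) \<or> run z p (b + 1) (b + 2 * p)"
    using nearest_break[OF p(3) pos[OF p(2)] r2 b0] .
  obtain e' p' where "p' \<in> S" "p < p'" "run z p' (e' - r * p') (e' + r * p')"
    using longer_period_near_edge[OF fin pos r cover p(2) b] by blast
  then have "p' \<in> Q" "p' > Max Q" unfolding Q_def[symmetric] p(1)[symmetric] by (auto simp: Q_def)
  then show False using Max_ge[OF finQ, of p'] by simp
qed

section \<open>Overlapping occurrences of a word\<close>

definition occurs :: "(int \<Rightarrow> 'c) \<Rightarrow> int \<Rightarrow> 'c list \<Rightarrow> bool" where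
  "occurs z s w \<longleftrightarrow> (\<forall>j<length w. z (s + int j) = w ! j)"

text \<open>Every positive \<open>p \<ge> length w\<close> qualifies vacuously, so the minimum
  exists even for words without a proper period.\<close>

definition period :: "'c list \<Rightarrow> nat" where
  "period w = (LEAST p. p > 0 \<and> (\<forall>j. j + p < length w \<longrightarrow> w ! j = w ! (j + p)))"

lemma period:
  "period w > 0" "j + period w < length w \<Longrightarrow> w ! j = w ! (j + period w)"
proof -
  let ?P = "\<lambda>p. p > 0 \<and> (\<forall>j. j + p < length w \<longrightarrow> w ! j = w ! (j + p))"
  have "?P (Suc (length w))" by simp
  then have "?P (period w)" unfolding period_def by (rule LeastI)
  then show "period w > 0" "j + period w < length w \<Longrightarrow> w ! j = w ! (j + period w)" by simp_all
qed

text \<open>The distance of two occurrences is itself a period of \<open>w\<close>, vacuously so if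
  they do not overlap.\<close>

lemma overlap_ge_period:
  assumes "occurs z s w" "occurs z s' w" "s < s'"
  shows "s + int (period w) \<le> s'"
proof -
  define d where "d = nat (s' - s)"
  have d: "d > 0" "s' = s + int d" using assms(3) unfolding d_def by auto
  have "w ! j = w ! (j + d)" if "j + d < length w" for j
    using assms(1)[unfolded occurs_def, rule_format, of "j + d"]
      assms(2)[unfolded occurs_def, rule_format, of j] that d(2) by (simp add: algebra_simps)
  then have "period w \<le> d" unfolding period_def using d(1) by (intro Least_le) auto
  then show ?thesis using d(2) by simp
qed

lemma middle_of_spaced_set:
  fixes F :: "int set"
  assumes fin: "finite F" and card: "2 * r < card F"
    and gap: "\<And>s s'. s \<in> F \<Longrightarrow> s' \<in> F \<Longrightarrow> s < s' \<Longrightarrow> s + p \<le> s'"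
  obtains a s b where "a \<in> F" "s \<in> F" "b \<in> F" "a + int r * p \<le> s" "s + int r * p \<le> b"
proof -
  define xs where "xs = sorted_list_of_set F"
  have xs: "set xs = F" "length xs = card F" "sorted_wrt (<) xs"
    using fin unfolding xs_def by (auto simp: strict_sorted_iff)
  have step: "i + k < length xs \<Longrightarrow> xs ! i + int k * p \<le> xs ! (i + k)" for i k
  proof (induction k)
    case (Suc k)
    have "xs ! (i + k) < xs ! (i + Suc k)" using xs(3) Suc.prems by (auto simp: sorted_wrt_iff_nth_less)
    then have "xs ! (i + k) + p \<le> xs ! (i + Suc k)"
      using Suc.prems xs(1) by (intro gap) (auto intro!: nth_mem)
    then show ?case using Suc by (simp add: algebra_simps)
  qed simp
  show ?thesis
  proof
    show "xs ! 0 \<in> F" "xs ! r \<in> F" "xs ! (2 * r) \<in> F"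
      unfolding xs(1)[symmetric] using card xs(2) by (intro nth_mem; simp)+
    show "xs ! 0 + int r * p \<le> xs ! r" using step[of 0 r] card xs(2) by simp
    show "xs ! r + int r * p \<le> xs ! (2 * r)" using step[of r r] card xs(2) by (simp add: mult_2)
  qed
qed

text \<open>All occurrences contain \<open>e\<close>. The middle one starts at least
  \<open>r\<close> periods before the last and ends at least \<open>r\<close> periods after the
  first, so it covers the whole window, which inherits the period of \<open>w\<close>.\<close>

lemma many_occurrences_imp_run:
  assumes fin: "finite F" and card: "2 * r < card F"
    and occ: "\<And>s. s \<in> F \<Longrightarrow> occurs z s w \<and> s \<le> e \<and> e < s + int (length w)"
  shows "run z (int (period w)) (e - int r * int (period w)) (e + int r * int (period w))"
proof -
  let ?p = "int (period w)"
  obtain a s b where *: "a \<in> F" "s \<in> F" "b \<in> F" "a + int r * ?p \<le> s" "s + int r * ?p \<le> b"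
  proof (rule middle_of_spaced_set[OF fin card, of ?p])
    show "s + ?p \<le> s'" if "s \<in> F" "s' \<in> F" "s < s'" for s s'
      using overlap_ge_period occ that by blast
  qed
  show ?thesis
    unfolding run_def
  proof (intro allI impI)
    fix t assume t: "e - int r * ?p \<le> t \<and> t + ?p \<le> e + int r * ?p"
    define j where "j = nat (t - s)"
    have j: "t = s + int j" unfolding j_def using t * occ[of b] by auto
    have len: "j + period w < length w" using t * occ[of a] j by auto
    have "z (s + int j) = w ! j" "z (s + int (j + period w)) = w ! (j + period w)"
      using occ[OF *(2)] len unfolding occurs_def by auto
    then show "z t = z (t + ?p)" using period(2)[OF len] j by (simp add: algebra_simps)
  qed
qed

text \<open>
  By the pigeonhole principle some word occurs at more than \<open>2 * r\<close> of the starting points of \<open>occ\<close>.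
\<close>

lemma many_parses_imp_periodic:
  fixes z :: "int \<Rightarrow> 'c" and w :: "nat \<Rightarrow> 'c list"
  assumes k: "k \<le> K" and L: "L = K * (2 * (2 ^ K + 1)) + 1"
    and occ: "\<And>e a. a < L \<Longrightarrow> \<exists>i<k. occurs z (s e a) (w i) \<and> s e a \<le> e \<and> e < s e a + int (length (w i))"
    and inj: "\<And>e. inj_on (s e) {..<L}"
  shows "\<exists>p>0. \<forall>t. z t = z (t + p)"
proof -
  define S where "S = (\<lambda>i. int (period (w i))) ` {..<k}"
  have finS: "finite S" unfolding S_def by simp
  have cardS: "card S \<le> K" 
    unfolding S_def using card_image_le[of "{..<k}" "\<lambda>i. int (period (w i))"] k by simp
  have pos: "p > 0" if "p \<in> S" for p using that period(1) unfolding S_def by auto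
  define r where "r = 2 ^ card S + (1::nat)"
  \<comment> \<open>\<open>r\<close> is the radius demanded by
    \<open>locally_periodic_imp_periodic\<close>. Its bound involves only \<open>K\<close>, so
    \<open>L\<close> can exceed \<open>2 * r\<close> for each of the at most \<open>K\<close> words,
    whatever the words are.\<close>
  have "r \<le> 2 ^ K + 1" unfolding r_def using cardS by (simp add: power_increasing)
  have "\<exists>p\<in>S. run z p (e - int r * p) (e + int r * p)" for e
  proof -
    obtain i where i: "\<And>a. a < L \<Longrightarrow> i a < k \<and> occurs z (s e a) (w (i a)) \<and> s e a \<le> e \<and> e < s e a + int (length (w (i a)))"
    proof -
      have "\<forall>a. \<exists>i. a < L \<longrightarrow> i < k \<and> occurs z (s e a) (w i) \<and> s e a \<le> e \<and> e < s e a + int (length (w i))"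
        using occ by blast
      from choice[OF this] obtain i where
        "\<forall>a. a < L \<longrightarrow> i a < k \<and> occurs z (s e a) (w (i a)) \<and> s e a \<le> e \<and> e < s e a + int (length (w (i a)))" ..
      then show ?thesis using that[of i] by simp
    qed
    have "\<exists>j\<in>{..<k}. 2 * r < card {a\<in>{..<L}. i a = j}"
    proof (rule ccontr)
      assume "\<not> ?thesis"
      then have le: "card {a\<in>{..<L}. i a = j} \<le> 2 * r" if "j < k" for j using that by (meson lessThan_iff not_less)
      have "{..<L} = (\<Union>j<k. {a\<in>{..<L}. i a = j})" using i by auto
      then have "L = card (\<Union>j<k. {a\<in>{..<L}. i a = j})" by (metis card_lessThan)
      also have "\<dots> \<le> (\<Sum>j<k. card {a\<in>{..<L}. i a = j})" by (rule card_UN_le) simp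
      also have "\<dots> \<le> (\<Sum>j<k. 2 * r)" using le by (intro sum_mono) auto
      also have "\<dots> \<le> K * (2 * (2 ^ K + 1))"
        unfolding sum_constant card_lessThan of_nat_id using k \<open>r \<le> _\<close> by (intro mult_le_mono) auto
      finally show False using L by simp
    qed
    then obtain j where j: "j < k" "2 * r < card {a\<in>{..<L}. i a = j}" by auto
    define F where "F = s e ` {a\<in>{..<L}. i a = j}"
    have "card F = card {a\<in>{..<L}. i a = j}" unfolding F_def
      by (intro card_image inj_on_subset[OF inj]) auto
    then have "run z (int (period (w j))) (e - int r * int (period (w j))) (e + int r * int (period (w j)))"
      using j i by (intro many_occurrences_imp_run[of F]) (auto simp: F_def)
    then show ?thesis using j unfolding S_def by auto
  qed
  then have "\<exists>p\<in>S. \<forall>t. z t = z (t + p)"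
    by (intro locally_periodic_imp_periodic[OF finS pos, of "int r"]) (auto simp: r_def)
  then show ?thesis using pos by blast
qed

section \<open>A defect theorem for infinite words\<close>

text \<open>Coinductive because the parse continues forever to the right. It says something only if
  \<open>[] \<notin> U\<close>, since the empty word would parse every sequence.\<close>

coinductive parses :: "'c list set \<Rightarrow> (int \<Rightarrow> 'c) \<Rightarrow> int \<Rightarrow> bool" for U z where
  step: "u \<in> U \<Longrightarrow> occurs z a u \<Longrightarrow> parses U z (a + int (length u)) \<Longrightarrow> parses U z a"

definition star :: "'c list set \<Rightarrow> 'c list set" where
  "star U = concat ` lists U"

text \<open>The combinatorial rank of \<open>W\<close>. The generators need not belong to
  \<open>W\<close>, which allows words to be replaced by pieces of them.\<close>

definition rank_le :: "'c list set \<Rightarrow> nat \<Rightarrow> bool" where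
  "rank_le W k \<longleftrightarrow> (\<exists>U. finite U \<and> [] \<notin> U \<and> card U \<le> k \<and> W \<subseteq> star U)"

text \<open>
  Reflection about the boundary between the positions \<open>-1\<close> and \<open>0\<close>, so that what ends before \<open>s\<close> is
  mapped to what starts at \<open>-s\<close>.
\<close>

definition reflect :: "(int \<Rightarrow> 'c) \<Rightarrow> int \<Rightarrow> 'c" where
  "reflect z i = z (- i - 1)"

lemma star_incl: "u \<in> U \<Longrightarrow> u \<in> star U"
  unfolding star_def by (rule image_eqI[of _ _ "[u]"]) auto

lemma star_append:
  assumes "u \<in> star U" "v \<in> star U"
  shows "u @ v \<in> star U"
proof -
  obtain us vs where "us \<in> lists U" "u = concat us" "vs \<in> lists U" "v = concat vs"
    using assms unfolding star_def by blast
  then show ?thesis unfolding star_def by (intro image_eqI[of _ _ "us @ vs"]) auto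
qed

lemma star_Nil: "[] \<in> star U"
  unfolding star_def by (auto intro!: image_eqI[of _ _ "[]"])

lemma star_trans:
  assumes "W \<subseteq> star V" "V \<subseteq> star U"
  shows "W \<subseteq> star U"
proof -
  have "concat vs \<in> star U" if "vs \<in> lists V" for vs
    using that
  proof induction
    case (Cons v vs)
    then show ?case using assms(2) star_append by auto
  qed (simp add: star_Nil)
  then have "star V \<subseteq> star U" unfolding star_def[of V] by blast
  then show ?thesis using assms(1) by simp
qed

lemma star_image_map: "map f ` star U \<subseteq> star (map f ` U)"
  unfolding star_def by (auto simp: map_concat intro!: image_eqI[of _ _ "map (map f) _"])

lemma star_image_rev: "rev ` star U \<subseteq> star (rev ` U)"
  unfolding star_def by (auto simp: rev_concat intro!: image_eqI[of _ _ "map rev (rev _)"])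

lemma rank_le_trans: "W \<subseteq> star V \<Longrightarrow> rank_le V k \<Longrightarrow> rank_le W k"
  unfolding rank_le_def by (meson star_trans)

lemma rank_le_mono: "rank_le W j \<Longrightarrow> j \<le> k \<Longrightarrow> rank_le W k"
  unfolding rank_le_def by (meson le_trans)

lemma rank_le_rev: "rank_le W k \<Longrightarrow> rank_le (rev ` W) k"
proof -
  assume "rank_le W k"
  then obtain U where U: "finite U" "[] \<notin> U" "card U \<le> k" "W \<subseteq> star U" unfolding rank_le_def by auto
  have "rev ` W \<subseteq> star (rev ` U)" using U(4) star_image_rev by blast
  moreover have "card (rev ` U) \<le> k" using card_image_le[OF U(1), of rev] U(3) by simp
  moreover have "[] \<notin> rev ` U" using U(2) by auto
  ultimately show ?thesis unfolding rank_le_def using U(1) by blast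
qed

lemma not_rank_le_0:
  assumes "w \<in> W" "w \<noteq> []"
  shows "\<not> rank_le W 0"
  using assms unfolding rank_le_def star_def by auto

lemma occurs_append:
  "occurs z a (u @ v) \<longleftrightarrow> occurs z a u \<and> occurs z (a + int (length u)) v"
proof
  assume *: "occurs z a (u @ v)"
  have "z (a + int (length u) + int j) = v ! j" if "j < length v" for j
    using *[unfolded occurs_def, rule_format, of "length u + j"] that
    by (simp add: add.assoc)
  moreover have "z (a + int j) = u ! j" if "j < length u" for j
    using *[unfolded occurs_def, rule_format, of j] that by (simp add: nth_append)
  ultimately show "occurs z a u \<and> occurs z (a + int (length u)) v" unfolding occurs_def by blast
next
  assume *: "occurs z a u \<and> occurs z (a + int (length u)) v"
  show "occurs z a (u @ v)"
    unfolding occurs_def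
  proof (intro allI impI)
    fix j assume j: "j < length (u @ v)"
    show "z (a + int j) = (u @ v) ! j"
    proof (cases "j < length u")
      case True
      then show ?thesis using * unfolding occurs_def by (simp add: nth_append)
    next
      case False
      have "j - length u < length v" using False j by auto
      then have "z (a + int (length u) + int (j - length u)) = v ! (j - length u)"
        using * unfolding occurs_def by blast
      moreover have "a + int (length u) + int (j - length u) = a + int j" using False by simp
      ultimately show ?thesis using False by (simp add: nth_append)
    qed
  qed
qed

lemma occurs_eq: "occurs z a u \<Longrightarrow> occurs z a v \<Longrightarrow> length u = length v \<Longrightarrow> u = v"
  unfolding occurs_def by (metis nth_equalityI)

lemma occurs_prefix:
  assumes "occurs z a u" "occurs z a v" "length u \<le> length v"
  shows "v = u @ drop (length u) v"
proof -
  have "v = take (length u) v @ drop (length u) v" by simp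
  moreover have "take (length u) v = u"
    using assms by (intro occurs_eq[of z a]) (auto simp: occurs_def)
  ultimately show ?thesis by metis
qed

lemma occurs_map: "occurs z a u \<Longrightarrow> occurs (f \<circ> z) a (map f u)"
  unfolding occurs_def by simp

lemma occurs_reflect:
  assumes "occurs z a u"
  shows "occurs (reflect z) (- (a + int (length u))) (rev u)"
  unfolding occurs_def
proof (intro allI impI)
  fix j assume j: "j < length (rev u)"
  define i where "i = length u - Suc j"
  have "i < length u" using j unfolding i_def by auto
  then have "z (a + int i) = u ! i" using assms unfolding occurs_def by blast
  moreover have "a + int i = - (- (a + int (length u)) + int j) - 1" using j unfolding i_def by auto
  ultimately have "reflect z (- (a + int (length u)) + int j) = u ! i"
    unfolding reflect_def by simp
  then show "reflect z (- (a + int (length u)) + int j) = rev u ! j"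
    using j unfolding i_def by (simp add: rev_nth)
qed

text \<open>Each word of \<open>W\<close> is expanded into factors from \<open>U\<close>. An empty
  word in \<open>W\<close> would have an expansion without factors, and the parse would not
  advance.\<close>

lemma parses_star:
  assumes W: "parses W z a" and "[] \<notin> W" "W \<subseteq> star U"
  shows "parses U z a"
proof -
  \<comment> \<open>The coinduction carries the list \<open>us\<close> of factors already fetched
    but not yet read; it is empty at the start.\<close>
  have "\<exists>us. us \<in> lists U \<and> occurs z a (concat us) \<and> parses W z (a + int (length (concat us)))"
    using W by (intro exI[of _ "[]"]) (auto simp: occurs_def)
  then show ?thesis
  proof (coinduction arbitrary: a)
    case (parses a)
    then obtain us where us: "us \<in> lists U" "occurs z a (concat us)"
      "parses W z (a + int (length (concat us)))" by blast
    obtain v vs where vs: "v \<in> U" "vs \<in> lists U" "occurs z a (v @ concat vs)"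
      "parses W z (a + int (length v) + int (length (concat vs)))"
    proof (cases us)
      case Nil
      then have "parses W z a" using us by simp
      then obtain w where w: "w \<in> W" "occurs z a w" "parses W z (a + int (length w))"
        by (cases rule: parses.cases) auto
      then obtain vs where vs: "vs \<in> lists U" "w = concat vs" using assms(3) unfolding star_def by blast
      moreover obtain v vs' where "vs = v # vs'" using w(1) vs assms(2) by (cases vs) auto
      ultimately show ?thesis using w that[of v vs'] by (simp add: add.assoc)
    next
      case (Cons v vs)
      then show ?thesis using us that[of v vs] by (simp add: add.assoc)
    qed
    then show ?case unfolding occurs_append by blast
  qed
qed

lemma parses_map:
  assumes "parses U z a"
  shows "parses (map f ` U) (f \<circ> z) a"
  using assms
proof (coinduction arbitrary: a)
  case (parses a)
  then obtain u where "u \<in> U" "occurs z a u" "parses U z (a + int (length u))"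
    by (cases rule: parses.cases) auto
  then show ?case by (intro exI[of _ "map f u"] exI[of _ a]) (auto intro: occurs_map)
qed

text \<open>
  If \<open>u' = u @ w\<close>, then replacing \<open>u'\<close> by \<open>w\<close> yields a smaller generating set over which the sequence
  again has two parses with distinct first words; the descent ends when \<open>w\<close> is already present.
\<close>

lemma defect:
  assumes "finite V" "[] \<notin> V" "u \<in> V" "u' \<in> V" "u \<noteq> u'"
    and "occurs z a u" "parses V z (a + int (length u))"
    and "occurs z a u'" "parses V z (a + int (length u'))"
  shows "rank_le V (card V - 1)"
  using assms
proof (induction "\<Sum>v\<in>V. length v" arbitrary: V u u' a rule: less_induct)
  case less
  note IH = less.hyps
  have main: "rank_le V (card V - 1)"
    if uV: "u \<in> V" "u' \<in> V" "u \<noteq> u'" and le: "length u \<le> length u'"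
      and occ: "occurs z a u" "parses V z (a + int (length u))"
        "occurs z a u'" "parses V z (a + int (length u'))" for u u'
  proof -
    define w where "w = drop (length u) u'"
    have u': "u' = u @ w" unfolding w_def using occurs_prefix[OF occ(1,3) le] .
    have w: "w \<noteq> []" using u' uV(3) by auto
    have u: "u \<noteq> []" using uV(1) less.prems(2) by auto
    define V' where "V' = insert w (V - {u'})"
    have uV': "u \<in> V'" and wV': "w \<in> V'" unfolding V'_def using uV by auto
    have "v \<in> star V'" if "v \<in> V" for v
    proof (cases "v = u'")
      case True
      then show ?thesis using u' star_append[OF star_incl[OF uV'] star_incl[OF wV']] by simp
    next
      case False
      then show ?thesis using that star_incl[of v V'] unfolding V'_def by simp
    qed
    then have sub: "V \<subseteq> star V'" by blast
    have fin': "finite V'" and ne': "[] \<notin> V'" unfolding V'_def using less.prems(1,2) w by auto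
    have card_minus: "card (V - {u'}) = card V - 1" using uV(2) less.prems(1) by simp
    show ?thesis
    proof (cases "w \<in> V - {u'}")
      case True
      then have "card V' = card V - 1" unfolding V'_def using card_minus by (simp add: insert_absorb)
      then show ?thesis unfolding rank_le_def using fin' ne' sub by auto
    next
      case False
      have "card V > 0" using uV(2) less.prems(1) by (auto simp: card_gt_0_iff)
      then have card': "card V' = card V"
        unfolding V'_def using False less.prems(1) card_minus by (simp del: card_Diff_insert)
      have "(\<Sum>v\<in>V'. length v) = length w + (\<Sum>v\<in>V - {u'}. length v)"
        unfolding V'_def using False less.prems(1) by (intro sum.insert) auto
      also have "\<dots> < length u' + (\<Sum>v\<in>V - {u'}. length v)" using u' u by simp
      also have "\<dots> = (\<Sum>v\<in>V. length v)" using uV(2) less.prems(1) by (simp add: sum.remove)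
      finally have smaller: "(\<Sum>v\<in>V'. length v) < (\<Sum>v\<in>V. length v)" .
      let ?b = "a + int (length u)"
      have refine: "parses V' z c" if "parses V z c" for c
        using parses_star[OF that less.prems(2) sub] .
      have w_occ: "occurs z ?b w" using occ(3) unfolding u' occurs_append by simp
      have w_parse: "parses V' z (?b + int (length w))"
        using refine[OF occ(4)] unfolding u' by (simp add: add.assoc)
      obtain v where v: "v \<in> V" "occurs z ?b v" "parses V z (?b + int (length v))"
        using occ(2) by (cases rule: parses.cases) auto
      \<comment> \<open>At \<open>?b\<close> one parse reads \<open>w\<close>. The other reads
        \<open>v\<close>, whose first word over \<open>V'\<close> is \<open>u\<close> if
        \<open>v = u'\<close> and \<open>v\<close> itself otherwise; both lie in
        \<open>V - {u'}\<close>, where \<open>w\<close> does not.\<close>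
      obtain x where x: "x \<in> V'" "x \<noteq> w" "occurs z ?b x" "parses V' z (?b + int (length x))"
      proof (cases "v = u'")
        case True
        have "parses V' z (?b + int (length u) + int (length w))"
          using refine[OF v(3)] unfolding True u' by (simp add: add.assoc)
        moreover have "occurs z ?b u" "occurs z (?b + int (length u)) w"
          using v(2) unfolding True u' occurs_append by auto
        ultimately have "parses V' z (?b + int (length u))" using parses.step[OF wV'] by blast
        moreover have "u \<noteq> w" using False uV(1,3) by auto
        ultimately show ?thesis using that[of u] uV' \<open>occurs z ?b u\<close> by blast
      next
        case vu: False
        then show ?thesis using that[of v] v refine False unfolding V'_def by blast
      qed
      have "rank_le V' (card V' - 1)"
        using IH[OF smaller fin' ne' wV' x(1) x(2)[symmetric] w_occ w_parse x(3,4)] .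
      then show ?thesis using rank_le_trans[OF sub] card' by simp
    qed
  qed
  show ?case
  proof (cases "length u \<le> length u'")
    case True
    then show ?thesis using main[of u u'] less.prems by blast
  next
    case False
    then show ?thesis using main[of u' u] less.prems by simp
  qed
qed

text \<open>As long as both parses read the same words they stay at the same position and the
  sequences agree. Words are nonempty, so this must stop before \<open>t\<close> is passed.\<close>

lemma first_difference:
  assumes "[] \<notin> V" "parses V y s" "parses V y' s" "s \<le> t" "y t \<noteq> y' t"
  shows "\<exists>b u u'. u \<in> V \<and> u' \<in> V \<and> u \<noteq> u' \<and> occurs y b u \<and> occurs y' b u' \<and>
    parses V y (b + int (length u)) \<and> parses V y' (b + int (length u'))"
  using assms
proof (induction "nat (t - s)" arbitrary: s rule: less_induct)
  case less
  obtain u where u: "u \<in> V" "occurs y s u" "parses V y (s + int (length u))"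
    using less.prems(2) by (cases rule: parses.cases) auto
  obtain u' where u': "u' \<in> V" "occurs y' s u'" "parses V y' (s + int (length u'))"
    using less.prems(3) by (cases rule: parses.cases) auto
  show ?case
  proof (cases "u = u'")
    case True
    have "length u > 0" using u(1) less.prems(1) by auto
    have "\<not> t < s + int (length u)"
    proof
      assume "t < s + int (length u)"
      then have "nat (t - s) < length u" using less.prems(4) by auto
      then have "y (s + int (nat (t - s))) = y' (s + int (nat (t - s)))"
        using u(2) u'(2) True unfolding occurs_def by metis
      then show False using less.prems(4,5) by simp
    qed
    then show ?thesis
      using less.hyps[of "s + int (length u)"] u u' True less.prems \<open>length u > 0\<close> by auto
  next
    case False
    then show ?thesis using u u' by blast
  qed
qed

text \<open>If \<open>map f\<close> is injective on \<open>V\<close>, the first two differing words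
  stay distinct and give two parses of the single sequence \<open>f \<circ> y\<close>, to which
  \<open>defect\<close> applies. If not, the image simply has fewer words.\<close>

lemma rank_drop_right:
  assumes V: "finite V" "[] \<notin> V" "card V \<le> Suc k"
    and "parses V y s" "parses V y' s" "s \<le> t" "y t \<noteq> y' t" and eq: "f \<circ> y = f \<circ> y'"
  shows "rank_le (map f ` V) k"
proof (cases "inj_on (map f) V")
  case True
  obtain b u u' where u: "u \<in> V" "u' \<in> V" "u \<noteq> u'" "occurs y b u" "occurs y' b u'"
    "parses V y (b + int (length u))" "parses V y' (b + int (length u'))"
    using first_difference[OF V(2) assms(4-7)] by blast
  have "map f u \<noteq> map f u'" using u True by (auto dest: inj_onD)
  moreover have "[] \<notin> map f ` V" using V(2) by auto
  ultimately have "rank_le (map f ` V) (card (map f ` V) - 1)"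
    using u V(1) occurs_map[OF u(4), of f] parses_map[OF u(6), of f]
      occurs_map[OF u(5), of f] parses_map[OF u(7), of f]
    by (intro defect[of _ "map f u" "map f u'" "f \<circ> y" b]) (auto simp: eq)
  then have "rank_le (map f ` V) (card V - 1)" using card_image[OF True] by simp
  then show ?thesis using V(3) by (auto elim: rank_le_mono)
next
  case False
  then have "card (map f ` V) < card V"
    using V(1) card_image_le[of V "map f"] eq_card_imp_inj_on[of V "map f"] by force
  moreover have "[] \<notin> map f ` V" using V(2) by auto
  moreover have "map f ` V \<subseteq> star (map f ` V)" using star_incl by (rule subsetI)
  ultimately show ?thesis unfolding rank_le_def
    using V by (intro exI[of _ "map f ` V"]) simp
qed

text \<open>The sequences differ on one side of the common cut \<open>s\<close>; a difference on its
  left is brought to the right by reflection. \<open>W\<close> is first replaced by its at most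
  \<open>Suc k\<close> generators.\<close>

lemma rank_drop:
  assumes W: "[] \<notin> W" "rank_le W (Suc k)"
    and y: "parses W y s" "parses (rev ` W) (reflect y) (- s)"
    and y': "parses W y' s" "parses (rev ` W) (reflect y') (- s)"
    and neq: "y \<noteq> y'" and eq: "f \<circ> y = f \<circ> y'"
  shows "rank_le (map f ` W) k"
proof -
  obtain U where U: "finite U" "[] \<notin> U" "card U \<le> Suc k" "W \<subseteq> star U"
    using W(2) unfolding rank_le_def by auto
  obtain t where t: "y t \<noteq> y' t" using neq by blast
  have "rank_le (map f ` U) k"
  proof (cases "s \<le> t")
    case True
    show ?thesis
      using rank_drop_right[OF U(1-3) parses_star[OF y(1) W(1) U(4)] parses_star[OF y'(1) W(1) U(4)] True t eq] .
  next
    case False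
    have r: "finite (rev ` U)" "[] \<notin> rev ` U" "card (rev ` U) \<le> Suc k"
      using U card_image_le[OF U(1), of rev] by auto
    have sub: "rev ` W \<subseteq> star (rev ` U)" using U(4) star_image_rev by blast
    have nW: "[] \<notin> rev ` W" using W(1) by auto
    have "f \<circ> reflect y = f \<circ> reflect y'" using eq unfolding reflect_def by (auto simp: fun_eq_iff)
    \<comment> \<open>Reflection takes a position \<open>t < s\<close> to
      \<open>- t - 1 \<ge> - s\<close>, to the right of the reflected cut.\<close>
    moreover have "reflect y (- t - 1) \<noteq> reflect y' (- t - 1)" using t unfolding reflect_def by simp
    moreover have "- s \<le> - t - 1" using False by simp
    ultimately have "rank_le (map f ` rev ` U) k"
      using rank_drop_right[OF r parses_star[OF y(2) nW sub] parses_star[OF y'(2) nW sub]] by blast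
    then have "rank_le (rev ` map f ` rev ` U) k" by (rule rank_le_rev)
    moreover have "rev ` map f ` rev ` U = map f ` U" by (simp add: image_comp comp_def rev_map)
    ultimately show ?thesis by simp
  qed
  moreover have "map f ` W \<subseteq> star (map f ` U)" using U(4) star_image_map by blast
  ultimately show ?thesis using rank_le_trans by blast
qed

section \<open>Clopen codings of a minimal system\<close>

text \<open>Stated for predicates instead of sets, so that conditions on codes are decomposed along
  their logical structure and values outside \<open>topspace X\<close> are ignored.\<close>

definition clopen_pred :: "'a topology \<Rightarrow> ('a \<Rightarrow> bool) \<Rightarrow> bool" where
  "clopen_pred X P \<longleftrightarrow> openin X {x \<in> topspace X. P x} \<and> closedin X {x \<in> topspace X. P x}"

lemma clopen_predD:
  assumes "clopen_pred X P"
  shows "openin X {x \<in> topspace X. P x}" "closedin X {x \<in> topspace X. P x}"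
  using assms unfolding clopen_pred_def by auto

lemma clopen_pred_mem: "openin X U \<Longrightarrow> closedin X U \<Longrightarrow> clopen_pred X (\<lambda>x. x \<in> U)"
proof -
  assume U: "openin X U" "closedin X U"
  then have "{x \<in> topspace X. x \<in> U} = U" using openin_subset by blast
  then show ?thesis using U unfolding clopen_pred_def by simp
qed

lemma clopen_pred_not: "clopen_pred X P \<Longrightarrow> clopen_pred X (\<lambda>x. \<not> P x)"
proof -
  assume P: "clopen_pred X P"
  have "{x \<in> topspace X. \<not> P x} = topspace X - {x \<in> topspace X. P x}" by auto
  then show ?thesis using P unfolding clopen_pred_def by (simp add: closedin_diff openin_diff)
qed

lemma clopen_pred_conj: "clopen_pred X P \<Longrightarrow> clopen_pred X Q \<Longrightarrow> clopen_pred X (\<lambda>x. P x \<and> Q x)"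
proof -
  assume PQ: "clopen_pred X P" "clopen_pred X Q"
  have "{x \<in> topspace X. P x \<and> Q x} = {x \<in> topspace X. P x} \<inter> {x \<in> topspace X. Q x}" by auto
  then show ?thesis using PQ unfolding clopen_pred_def by (simp add: openin_Int closedin_Int)
qed

lemma clopen_pred_ball:
  assumes "finite I" "\<And>i. i \<in> I \<Longrightarrow> clopen_pred X (P i)"
  shows "clopen_pred X (\<lambda>x. \<forall>i\<in>I. P i x)"
  using assms
proof (induction I rule: finite_induct)
  case empty
  show ?case unfolding clopen_pred_def by simp
next
  case (insert i I)
  then have "clopen_pred X (\<lambda>x. P i x \<and> (\<forall>i\<in>I. P i x))" by (intro clopen_pred_conj) auto
  then show ?case by simp
qed

lemma clopen_pred_bex:
  assumes "finite I" "\<And>i. i \<in> I \<Longrightarrow> clopen_pred X (P i)"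
  shows "clopen_pred X (\<lambda>x. \<exists>i\<in>I. P i x)"
proof -
  have "clopen_pred X (\<lambda>x. \<not> (\<forall>i\<in>I. \<not> P i x))"
    using assms by (intro clopen_pred_not clopen_pred_ball) auto
  then show ?thesis by simp
qed

lemma clopen_pred_compose:
  assumes f: "continuous_map X Y f" and P: "clopen_pred Y P"
  shows "clopen_pred X (\<lambda>x. P (f x))"
proof -
  have "{x \<in> topspace X. P (f x)} = {x \<in> topspace X. f x \<in> {y \<in> topspace Y. P y}}"
    using continuous_map_image_subset_topspace[OF f] by auto
  then show ?thesis
    unfolding clopen_pred_def
    using openin_continuous_map_preimage[OF f clopen_predD(1)[OF P]]
      closedin_continuous_map_preimage[OF f clopen_predD(2)[OF P]] by metis
qed

lemma closedin_all_clopen: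
  assumes "\<And>t. clopen_pred X (P t)"
  shows "closedin X {x \<in> topspace X. \<forall>t. P t x}"
proof -
  have "{x \<in> topspace X. \<forall>t. P t x} = (\<Inter>t. {x \<in> topspace X. P t x})" by auto
  then show ?thesis using assms unfolding clopen_pred_def by auto
qed

section \<open>Integer iterates of a homeomorphism\<close>

lemma homeomorphic_map_facts:
  assumes "homeomorphic_map X X T"
  shows "T ` topspace X = topspace X" "inj_on T (topspace X)" "continuous_map X X T" "open_map X X T"
  using assms by (auto simp: homeomorphic_eq_everything_map)

lemma int_iterate_0 [simp]: "int_iterate X T 0 x = x"
  by (simp add: int_iterate_def)

lemma int_iterate_int: "int_iterate X T (int j) x = (T ^^ j) x"
  by (simp add: int_iterate_def)

lemma continuous_map_int_iterate:
  assumes h: "homeomorphic_map X X T"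
  shows "continuous_map X X (int_iterate X T n)"
proof -
  have pow: "continuous_map X X (f ^^ k)" if "continuous_map X X f" for f k
  proof (induction k)
    case (Suc k)
    then show ?case using continuous_map_compose[OF Suc that] by (simp add: comp_def)
  qed (simp add: id_def)
  let ?g = "inv_into (topspace X) T"
  note T = homeomorphic_map_facts[OF h]
  have g: "?g x \<in> topspace X" "T (?g x) = x" if "x \<in> topspace X" for x
    using that T(1) inv_into_into[of x T "topspace X"] f_inv_into_f[of x T "topspace X"] by auto
  have "continuous_map X X ?g"
    unfolding continuous_map_def
  proof (intro conjI allI impI)
    show "?g \<in> topspace X \<rightarrow> topspace X" using g by auto
    fix U assume U: "openin X U"
    have "{x \<in> topspace X. ?g x \<in> U} = T ` U"
    proof (intro set_eqI iffI)
      fix x assume "x \<in> {x \<in> topspace X. ?g x \<in> U}"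
      then show "x \<in> T ` U" using g(2)[of x] by (intro image_eqI[of _ _ "?g x"]) auto
    next
      fix x assume "x \<in> T ` U"
      then obtain y where y: "y \<in> U" "x = T y" by auto
      then have "y \<in> topspace X" using openin_subset[OF U] by auto
      then show "x \<in> {x \<in> topspace X. ?g x \<in> U}" using y T(1,2) by auto
    qed
    then show "openin X {x \<in> topspace X. ?g x \<in> U}" using T(4) U unfolding open_map_def by simp
  qed
  then show ?thesis unfolding int_iterate_def using pow T(3) by simp
qed

lemma int_iterate_in_topspace:
  assumes "homeomorphic_map X X T" "x \<in> topspace X"
  shows "int_iterate X T n x \<in> topspace X"
  using continuous_map_image_subset_topspace[OF continuous_map_int_iterate[OF assms(1), of n]] assms(2) by auto

lemma int_iterate_Suc:
  assumes h: "homeomorphic_map X X T" and x: "x \<in> topspace X"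
  shows "int_iterate X T (n + 1) x = T (int_iterate X T n x)"
proof (cases "n \<ge> 0")
  case True
  then have "nat (n + 1) = Suc (nat n)" by simp
  then show ?thesis using True by (simp add: int_iterate_def)
next
  case False
  define m where "m = nat (- n) - 1"
  have m: "nat (- n) = Suc m" using False unfolding m_def by simp
  let ?g = "inv_into (topspace X) T"
  note T = homeomorphic_map_facts[OF h]
  have n: "n + 1 = - int m" using m False by simp
  \<comment> \<open>For \<open>m = 0\<close> the exponent \<open>n + 1\<close> is 0, where the
    definition switches to its forward branch.\<close>
  have eq: "int_iterate X T (n + 1) x = (?g ^^ m) x"
    unfolding n by (cases "m = 0") (auto simp: int_iterate_def)
  then have "(?g ^^ m) x \<in> T ` topspace X" using int_iterate_in_topspace[OF assms] T(1) by metis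
  then have "T (?g ((?g ^^ m) x)) = (?g ^^ m) x" by (rule f_inv_into_f)
  then show ?thesis using False m eq by (simp add: int_iterate_def)
qed

lemma int_iterate_add:
  assumes h: "homeomorphic_map X X T" and x: "x \<in> topspace X"
  shows "int_iterate X T (m + n) x = int_iterate X T m (int_iterate X T n x)"
proof (induction m rule: int_induct[where k = 0])
  case (step1 i)
  then show ?case
    using int_iterate_Suc[OF h x, of "i + n"] int_iterate_Suc[OF h int_iterate_in_topspace[OF h x], of i n]
    by (simp add: algebra_simps)
next
  case (step2 i)
  let ?y = "int_iterate X T n x"
  have "T (int_iterate X T (i - 1 + n) x) = T (int_iterate X T (i - 1) ?y)"
    using step2 int_iterate_Suc[OF h x, of "i - 1 + n"]
      int_iterate_Suc[OF h int_iterate_in_topspace[OF h x], of "i - 1" n] by (simp add: algebra_simps)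
  then show ?case
    using homeomorphic_map_facts(2)[OF h] int_iterate_in_topspace[OF h] x by (auto dest!: inj_onD)
qed simp

lemma int_iterate_semiconj:
  assumes hX: "homeomorphic_map X X T" and hY: "homeomorphic_map Y Y S"
    and \<alpha>: "\<And>x. x \<in> topspace X \<Longrightarrow> \<alpha> x \<in> topspace Y"
    and eq: "\<And>x. x \<in> topspace X \<Longrightarrow> \<alpha> (T x) = S (\<alpha> x)" and x: "x \<in> topspace X"
  shows "\<alpha> (int_iterate X T n x) = int_iterate Y S n (\<alpha> x)"
proof (induction n rule: int_induct[where k = 0])
  case (step1 i)
  then show ?case
    using int_iterate_Suc[OF hX x, of i] int_iterate_Suc[OF hY \<alpha>[OF x], of i]
      eq[OF int_iterate_in_topspace[OF hX x, of i]] by simp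
next
  case (step2 i)
  have "S (\<alpha> (int_iterate X T (i - 1) x)) = S (int_iterate Y S (i - 1) (\<alpha> x))"
    using int_iterate_Suc[OF hX x, of "i - 1"] int_iterate_Suc[OF hY \<alpha>[OF x], of "i - 1"] step2
      eq[OF int_iterate_in_topspace[OF hX x, of "i - 1"]] by simp
  then show ?case
    using homeomorphic_map_facts(2)[OF hY] int_iterate_in_topspace[OF hY \<alpha>[OF x]]
      \<alpha>[OF int_iterate_in_topspace[OF hX x]] by (auto dest!: inj_onD)
qed simp

section \<open>Codes of the points of a minimal system\<close>

locale coded_minimal_system =
  fixes Y :: "'b topology" and S :: "'b \<Rightarrow> 'b" and G :: "nat \<Rightarrow> 'b set"
  assumes minimal: "minimal_system Y S"
    and clopen_G: "\<And>i. clopen_pred Y (\<lambda>y. y \<in> G i)"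
    and separating: "\<And>y y'. y \<in> topspace Y \<Longrightarrow> y' \<in> topspace Y \<Longrightarrow> y \<noteq> y' \<Longrightarrow> \<exists>i. y \<in> G i \<longleftrightarrow> y' \<notin> G i"
begin

abbreviation iter :: "int \<Rightarrow> 'b \<Rightarrow> 'b" where
  "iter \<equiv> int_iterate Y S"

text \<open>With sets as letters, passing from \<open>m'\<close>-codes to coarser
  \<open>m\<close>-codes is the letter map \<open>\<lambda>A. A \<inter> {..<m}\<close>, which plays
  the part of \<open>f\<close> in \<open>rank_drop\<close>.\<close>

definition code :: "nat \<Rightarrow> 'b \<Rightarrow> int \<Rightarrow> nat set" where
  "code m y t = {i. i < m \<and> iter t y \<in> G i}"

lemma homeo: "homeomorphic_map Y Y S" and compact: "compact_space Y" and nonempty: "topspace Y \<noteq> {}"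
  and Hausdorff: "Hausdorff_space Y"
  using minimal metrizable_imp_Hausdorff_space unfolding minimal_system_def dynamical_system_def by auto

lemma invariant_closed_eq:
  assumes F: "closedin Y F" "F \<noteq> {}" and inv: "\<And>y n. y \<in> F \<Longrightarrow> iter n y \<in> F"
  shows "F = topspace Y"
proof
  show sub: "F \<subseteq> topspace Y" using F(1) by (rule closedin_subset)
  obtain y where y: "y \<in> F" using F(2) by blast
  have "orbit_of Y S y \<subseteq> F" unfolding orbit_of_def using inv[OF y] by blast
  then have "Y closure_of orbit_of Y S y \<subseteq> F" using F(1) by (rule closure_of_minimal)
  moreover have "Y closure_of orbit_of Y S y = topspace Y"
    using minimal y sub unfolding minimal_system_def by blast
  ultimately show "topspace Y \<subseteq> F" by simp
qed

lemma code_subset: "code m y t \<subseteq> {..<m}"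
  unfolding code_def by auto

lemma code_iter: "y \<in> topspace Y \<Longrightarrow> code m (iter s y) t = code m y (t + s)"
  unfolding code_def by (simp add: int_iterate_add[OF homeo])

lemma code_restrict: "m \<le> m' \<Longrightarrow> code m y = (\<lambda>A. A \<inter> {..<m}) \<circ> code m' y"
  unfolding code_def by (auto simp: fun_eq_iff)

lemma code_eq_mono: "code m' y = code m' y' \<Longrightarrow> m \<le> m' \<Longrightarrow> code m y = code m y'"
  by (simp add: code_restrict[of m m'])

lemma code_separates:
  assumes "y \<in> topspace Y" "y' \<in> topspace Y" "y \<noteq> y'"
  shows "\<exists>m. code m y \<noteq> code m y'"
proof -
  obtain i where i: "y \<in> G i \<longleftrightarrow> y' \<notin> G i" using separating[OF assms] by blast
  have "code (Suc i) y 0 \<noteq> code (Suc i) y' 0"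
  proof
    assume "code (Suc i) y 0 = code (Suc i) y' 0"
    then have "i \<in> code (Suc i) y 0 \<longleftrightarrow> i \<in> code (Suc i) y' 0" by simp
    then show False using i unfolding code_def by auto
  qed
  then show ?thesis by metis
qed

lemma clopen_code_eq: "clopen_pred Y (\<lambda>y. code m y t = A)"
proof (cases "A \<subseteq> {..<m}")
  case True
  have iff: "code m y t = A \<longleftrightarrow> (\<forall>i\<in>{..<m}. if i \<in> A then iter t y \<in> G i else iter t y \<notin> G i)" for y
    using True unfolding code_def by auto
  have G: "clopen_pred Y (\<lambda>y. iter t y \<in> G i)" for i
    by (rule clopen_pred_compose[OF continuous_map_int_iterate[OF homeo] clopen_G])
  have "clopen_pred Y (\<lambda>y. if i \<in> A then iter t y \<in> G i else iter t y \<notin> G i)" for i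
    using G clopen_pred_not[OF G] by (cases "i \<in> A") simp_all
  then show ?thesis unfolding iff by (intro clopen_pred_ball) auto
next
  case False
  then have "code m y t \<noteq> A" for y using code_subset by blast
  then show ?thesis unfolding clopen_pred_def by simp
qed

lemma clopen_code: "clopen_pred Y (\<lambda>y. R (code m y t))"
proof -
  have "clopen_pred Y (\<lambda>y. \<exists>A\<in>{A \<in> Pow {..<m}. R A}. code m y t = A)"
    by (intro clopen_pred_bex clopen_code_eq) auto
  moreover have "(\<exists>A\<in>{A \<in> Pow {..<m}. R A}. code m y t = A) \<longleftrightarrow> R (code m y t)" for y
    using code_subset by auto
  ultimately show ?thesis by simp
qed

text \<open>The points whose code has period \<open>p\<close> form a closed invariant set, so by
  minimality one such point forces all of them, with the same \<open>p\<close>.\<close>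

lemma periodic_code:
  assumes "y \<in> topspace Y" "\<forall>t. code m y t = code m y (t + p)" "y' \<in> topspace Y"
  shows "code m y' t = code m y' (t + p)"
proof -
  let ?F = "{y \<in> topspace Y. \<forall>t. code m y t = code m y (t + p)}"
  have "clopen_pred Y (\<lambda>y. \<exists>A\<in>Pow {..<m}. code m y t = A \<and> code m y (t + p) = A)" for t
    by (intro clopen_pred_bex clopen_pred_conj clopen_code_eq) auto
  moreover have "(\<exists>A\<in>Pow {..<m}. code m y t = A \<and> code m y (t + p) = A) \<longleftrightarrow> code m y t = code m y (t + p)" for y t
    using code_subset by auto
  ultimately have "closedin Y ?F" by (intro closedin_all_clopen) simp
  moreover have "iter n y \<in> ?F" if "y \<in> ?F" for y n
  proof -
    note y = conjunct1[OF CollectD[OF that]] and per = conjunct2[OF CollectD[OF that]]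
    have "code m (iter n y) t = code m (iter n y) (t + p)" for t
    proof -
      have "t + n + p = t + p + n" by simp
      then show ?thesis using per[rule_format, of "t + n"] unfolding code_iter[OF y] by (simp only:)
    qed
    then show ?thesis by (intro CollectI conjI allI int_iterate_in_topspace[OF homeo y])
  qed
  moreover have "y \<in> ?F" using assms(1,2) by (intro CollectI conjI)
  ultimately have "?F = topspace Y" by (intro invariant_closed_eq) blast+
  then have "y' \<in> ?F" using assms(3) by (simp only:)
  from conjunct2[OF CollectD[OF this]] show ?thesis ..
qed

lemma conjugate_to_subshift:
  assumes inj: "\<And>y y'. y \<in> topspace Y \<Longrightarrow> y' \<in> topspace Y \<Longrightarrow> code m y = code m y' \<Longrightarrow> y = y'"
  shows "\<exists>(A :: nat set) Z. subshift A Z \<and> conjugate_systems Y S (subtopology (full_shift A) Z) shift_map"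
proof -
  \<comment> \<open>\<open>set_encode\<close> turns the letters into natural numbers up to
    \<open>2 ^ m\<close>; including \<open>2 ^ m\<close> itself leaves two letters even for
    \<open>m = 0\<close>.\<close>
  define A where "A = {..2 ^ m :: nat}"
  define \<phi> where "\<phi> y = (\<lambda>t. set_encode (code m y t))" for y
  define Z where "Z = \<phi> ` topspace Y"
  have fin: "finite (code m y t)" for y t by (rule finite_subset[OF code_subset]) simp
  have "(\<Sum>i\<in>code m y t. 2 ^ i) \<le> (2::nat) ^ m" for y t
  proof -
    have "(\<Sum>i\<in>code m y t. 2 ^ i) \<le> (\<Sum>i<m. (2::nat) ^ i)" using code_subset by (intro sum_mono2) auto
    also have "\<dots> \<le> 2 ^ m" by (induction m) auto
    finally show ?thesis .
  qed
  then have in_A: "\<phi> y t \<in> A" for y t unfolding \<phi>_def A_def set_encode_def by simp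
  have cont_t: "continuous_map Y (discrete_topology A) (\<lambda>y. \<phi> y t)" for t
    unfolding continuous_map_def
  proof (intro conjI allI impI)
    show "(\<lambda>y. \<phi> y t) \<in> topspace Y \<rightarrow> topspace (discrete_topology A)" using in_A by simp
    show "openin Y {x \<in> topspace Y. \<phi> x t \<in> U}" for U
      using clopen_predD(1)[OF clopen_code[of "\<lambda>C. set_encode C \<in> U" m t]] unfolding \<phi>_def .
  qed
  then have cont: "continuous_map Y (full_shift A) \<phi>"
    unfolding full_shift_def continuous_map_componentwise_UNIV by simp
  have haus: "Hausdorff_space (full_shift A)"
    unfolding full_shift_def by (simp add: Hausdorff_space_product_topology)
  have top: "topspace (full_shift A) = {f. range f \<subseteq> A}"
    unfolding full_shift_def by (auto simp: PiE_UNIV_domain)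
  have Z_top: "Z \<subseteq> topspace (full_shift A)" unfolding top Z_def using in_A by auto
  have "inj_on \<phi> (topspace Y)"
  proof (rule inj_onI)
    fix y y' assume y: "y \<in> topspace Y" "y' \<in> topspace Y" and eq: "\<phi> y = \<phi> y'"
    have "code m y t = code m y' t" for t
      using fun_cong[OF eq, of t] inj_on_set_encode fin unfolding \<phi>_def by (auto dest!: inj_onD)
    then show "y = y'" using inj y by blast
  qed
  moreover have "continuous_map Y (subtopology (full_shift A) Z) \<phi>"
    using cont unfolding Z_def by (auto simp: continuous_map_in_subtopology)
  moreover have "\<phi> ` topspace Y = topspace (subtopology (full_shift A) Z)"
    using Z_top unfolding Z_def by auto
  ultimately have homeo\<phi>: "homeomorphic_map Y (subtopology (full_shift A) Z) \<phi>"
    using compact haus by (intro continuous_imp_homeomorphic_map Hausdorff_space_subtopology) auto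
  have shift: "\<phi> (S y) = shift_map (\<phi> y)" if "y \<in> topspace Y" for y
  proof -
    have "S y = iter 1 y" using int_iterate_Suc[OF homeo that, of 0] by simp
    then show ?thesis using code_iter[OF that, of m 1] unfolding \<phi>_def shift_map_def by simp
  qed
  have "compactin (full_shift A) Z"
    unfolding Z_def using compact cont by (auto simp: compact_space_def intro: image_compactin)
  then have closed: "closedin (full_shift A) Z" using haus by (intro compactin_imp_closedin)
  have "shift_map ` Z = \<phi> ` S ` topspace Y" unfolding Z_def using shift by (auto simp: image_iff)
  then have "shift_map ` Z = Z" unfolding Z_def using homeomorphic_map_facts(1)[OF homeo] by simp
  moreover have "Z \<noteq> {}" unfolding Z_def using nonempty by simp
  moreover have "card A \<ge> 2" unfolding A_def by simp
  ultimately have "subshift A Z"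
    unfolding subshift_def subsystem_def using closed by (simp add: A_def)
  then show ?thesis unfolding conjugate_systems_def using homeo\<phi> shift by blast
qed

text \<open>Codes are compared along the whole orbit, not on a window around 0. This makes the
  distance invariant under \<open>S\<close>, but in general its topology is finer than that of
  \<open>Y\<close>.\<close>

definition code_dist :: "'b \<Rightarrow> 'b \<Rightarrow> real" where
  "code_dist y y' = (if y = y' then 0 else inverse (real (Suc (LEAST m. code m y \<noteq> code m y'))))"

lemma code_dist_less:
  assumes "y \<in> topspace Y" "y' \<in> topspace Y"
  shows "code_dist y y' < inverse (real (Suc m)) \<longleftrightarrow> code m y = code m y'"
proof (cases "y = y'")
  case False
  define D where "D = (LEAST m. code m y \<noteq> code m y')"
  have D: "code D y \<noteq> code D y'" unfolding D_def using code_separates[OF assms False] by (rule LeastI_ex)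
  have least: "k < D \<Longrightarrow> code k y = code k y'" for k unfolding D_def by (drule not_less_Least) simp
  have "code_dist y y' = inverse (real (Suc D))" using False unfolding code_dist_def D_def by simp
  then have "code_dist y y' < inverse (real (Suc m)) \<longleftrightarrow> m < D" by simp
  moreover have "m < D \<longleftrightarrow> code m y = code m y'"
    using D least code_eq_mono[of m y y' D] by (cases "m < D") auto
  ultimately show ?thesis by blast
qed (simp add: code_dist_def)

lemma Metric_space_code_dist: "Metric_space (topspace Y) code_dist"
proof
  show "0 \<le> code_dist x y" for x y unfolding code_dist_def by simp
  show "code_dist x y = code_dist y x" for x y
    unfolding code_dist_def by (simp add: eq_commute)
  show "code_dist x y = 0 \<longleftrightarrow> x = y" for x y unfolding code_dist_def by (simp del: of_nat_Suc)
  show "code_dist x z \<le> code_dist x y + code_dist y z"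
    if xyz: "x \<in> topspace Y" "y \<in> topspace Y" "z \<in> topspace Y" for x y z
  proof (rule ccontr)
    assume "\<not> ?thesis"
    then have lt: "code_dist x y + code_dist y z < code_dist x z" by simp
    have nn: "code_dist a b \<ge> 0" for a b unfolding code_dist_def by simp
    have "x \<noteq> z" using lt nn[of x y] nn[of y z] by (auto simp: code_dist_def)
    then obtain m where m: "code_dist x z = inverse (real (Suc m))" unfolding code_dist_def by auto
    then have "code_dist x y < inverse (real (Suc m))" "code_dist y z < inverse (real (Suc m))"
      using lt nn[of x y] nn[of y z] by linarith+
    then have "code m x = code m z" using xyz by (simp only: code_dist_less)
    then have "code_dist x z < inverse (real (Suc m))" using xyz by (simp only: code_dist_less)
    then show False using m by simp
  qed
qed

text \<open>If \<open>m\<close>-codes have a period, a whole code is fixed by the letters of one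
  period. The balls of \<open>code_dist\<close> are then open in \<open>Y\<close>, so the identity
  is a continuous bijection from a compact onto a Hausdorff space, and the two topologies
  agree.\<close>

lemma odometerI:
  assumes cantor: "cantor_space Y"
    and per: "\<And>m. \<exists>p>0. \<exists>y\<in>topspace Y. \<forall>t. code m y t = code m y (t + p)"
  shows "odometer Y S"
proof -
  interpret M: Metric_space "topspace Y" code_dist by (rule Metric_space_code_dist)
  have cylinder: "openin Y {y' \<in> topspace Y. code m y = code m y'}" if y: "y \<in> topspace Y" for m y
  proof -
    obtain p y0 where p: "p > 0" and y0: "y0 \<in> topspace Y" "\<forall>t. code m y0 t = code m y0 (t + p)"
      using per[of m] by (elim exE conjE bexE)
    have mod: "code m y t = code m y (t mod p)" if "y \<in> topspace Y" for y t
    proof -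
      have add: "code m y s = code m y (s + int k * p)" for s k
      proof (induction k)
        case (Suc k)
        have "code m y (s + int k * p) = code m y (s + int k * p + p)" using y0 that by (rule periodic_code)
        then show ?case using Suc by (simp add: algebra_simps)
      qed simp
      show ?thesis
      proof (cases "t div p \<ge> 0")
        case True
        then show ?thesis using add[of "t mod p" "nat (t div p)"] by (simp add: mult.commute)
      next
        case False
        then have "t + int (nat (- (t div p))) * p = t - t div p * p" by simp
        also have "\<dots> = t mod p" by (simp add: minus_div_mult_eq_mod)
        finally show ?thesis using add[of t "nat (- (t div p))"] by simp
      qed
    qed
    have "code m y = code m y' \<longleftrightarrow> (\<forall>t\<in>{0..<p}. code m y' t = code m y t)" if "y' \<in> topspace Y" for y'
    proof
      assume *: "\<forall>t\<in>{0..<p}. code m y' t = code m y t"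
      have "code m y t = code m y' t" for t
        using mod[OF y, of t] mod[OF that, of t] * p by simp
      then show "code m y = code m y'" by (rule ext)
    qed auto
    then have "{y' \<in> topspace Y. code m y = code m y'} = {y' \<in> topspace Y. \<forall>t\<in>{0..<p}. code m y' t = code m y t}"
      by blast
    moreover have "clopen_pred Y (\<lambda>y'. \<forall>t\<in>{0..<p}. code m y' t = code m y t)"
      by (intro clopen_pred_ball clopen_code_eq) auto
    ultimately show ?thesis by (simp only: clopen_predD(1))
  qed
  have "continuous_map Y M.mtopology id"
    unfolding continuous_map_def
  proof (intro conjI allI impI)
    fix U assume U: "openin M.mtopology U"
    have "openin Y U"
    proof (subst openin_subopen, intro ballI)
      fix y assume y: "y \<in> U"
      obtain r where r: "r > 0" "M.mball y r \<subseteq> U" using U y unfolding M.openin_mtopology by blast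
      have yY: "y \<in> topspace Y" using U y M.openin_mtopology by blast
      obtain m where m: "inverse (real (Suc m)) < r" using reals_Archimedean[OF r(1)] by blast
      have "{y' \<in> topspace Y. code m y = code m y'} \<subseteq> M.mball y r"
      proof clarify
        fix y' assume "y' \<in> topspace Y" "code m y = code m y'"
        moreover from this have "code_dist y y' < r" using code_dist_less[OF yY, of y' m] m by linarith
        ultimately show "y' \<in> M.mball y r" using yY by simp
      qed
      then show "\<exists>V. openin Y V \<and> y \<in> V \<and> V \<subseteq> U" using cylinder[OF yY, of m] r(2) yY by blast
    qed
    then show "openin Y {x \<in> topspace Y. id x \<in> U}" 
      using openin_subset[of Y U] by (simp add: Collect_conj_eq Int_absorb1)
  qed simp
  then have "homeomorphic_map Y M.mtopology id"
    using compact M.Hausdorff_space_mtopology by (intro continuous_imp_homeomorphic_map) auto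
  then have top: "M.mtopology = Y" by simp
  have isom: "code_dist (S x) (S y) = code_dist x y" if xy: "x \<in> topspace Y" "y \<in> topspace Y" for x y
  proof -
    have "S z = iter 1 z" if "z \<in> topspace Y" for z using int_iterate_Suc[OF homeo that, of 0] by simp
    then have S: "code m (S z) t = code m z (t + 1)" if "z \<in> topspace Y" for m z t
      using code_iter[OF that, of m 1] that by simp
    have "code m (S x) = code m (S y) \<longleftrightarrow> code m x = code m y" for m
    proof
      assume *: "code m (S x) = code m (S y)"
      have "code m x t = code m y t" for t using fun_cong[OF *, of "t - 1"] S xy by simp
      then show "code m x = code m y" by (rule ext)
    qed (simp add: fun_eq_iff S xy)
    moreover have "S x = S y \<longleftrightarrow> x = y"
      using homeomorphic_map_facts(2)[OF homeo] xy by (auto dest: inj_onD)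
    ultimately show ?thesis unfolding code_dist_def by simp
  qed
  show ?thesis
    unfolding odometer_def using cantor minimal Metric_space_code_dist top isom by blast
qed

end

section \<open>Kakutani-Rokhlin towers\<close>

text \<open>In a compact Hausdorff space quasi-components are components, here single points; a
  quasi-component can be separated from the compact complement of \<open>U\<close>.\<close>

lemma clopen_neighbourhood:
  assumes Y: "compact_space Y" "Hausdorff_space Y" "totally_disconnected_space Y"
    and U: "openin Y U" "y \<in> U"
  shows "\<exists>V. openin Y V \<and> closedin Y V \<and> y \<in> V \<and> V \<subseteq> U"
proof -
  let ?C = "quasi_component_of_set Y y"
  have y: "y \<in> topspace Y" using U openin_subset by blast
  have C: "?C \<in> quasi_components_of Y" using y by (simp add: quasi_component_in_quasi_components_of)
  have "quasi_components_of Y = connected_components_of Y"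
    using Y by (intro quasi_eq_connected_components_of) auto
  then have "connectedin Y ?C" using C connectedin_connected_components_of by metis
  then obtain a where "?C \<subseteq> {a}" using Y(3) unfolding totally_disconnected_space_def by blast
  moreover have "y \<in> ?C" using y by simp
  ultimately have Cy: "?C = {y}" by blast
  have "compactin Y (topspace Y - U)"
    using U Y(1) by (intro closedin_compact_space closedin_diff) auto
  then have "separated_between Y {y} (topspace Y - U)"
    using separated_between_quasi_component_compact[OF C] U unfolding Cy by (simp add: disjnt_def)
  then obtain V W where VW: "openin Y V" "openin Y W" "V \<union> W = topspace Y" "disjnt V W"
    "{y} \<subseteq> V" "topspace Y - U \<subseteq> W" unfolding separated_between_def by blast
  have "topspace Y - W = V" using VW(3,4) openin_subset[OF VW(1)] unfolding disjnt_def by blast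
  then have "closedin Y V" using VW(2) by (metis closedin_diff closedin_topspace)
  moreover have "V \<subseteq> U" using VW openin_subset[OF VW(1)] unfolding disjnt_def by blast
  ultimately show ?thesis using VW by blast
qed

text \<open>For each \<open>n\<close>, finitely many clopen sets contained in balls of radius
  \<open>1 / (n + 1)\<close> cover \<open>Y\<close>. Points more than twice this radius apart never
  lie in the same set.\<close>

lemma separating_clopen_sequence:
  assumes Y: "compact_space Y" "metrizable_space Y" "totally_disconnected_space Y"
  obtains G :: "nat \<Rightarrow> 'b set" where "\<And>i. clopen_pred Y (\<lambda>y. y \<in> G i)"
    "\<And>y y'. y \<in> topspace Y \<Longrightarrow> y' \<in> topspace Y \<Longrightarrow> y \<noteq> y' \<Longrightarrow> \<exists>i. y \<in> G i \<longleftrightarrow> y' \<notin> G i"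
proof -
  obtain M d where Md: "Metric_space M d" "Y = Metric_space.mtopology M d"
    using Y(2) unfolding metrizable_space_def by blast
  interpret Metric_space M d by (rule Md(1))
  have top: "topspace Y = M" using Md(2) by simp
  have haus: "Hausdorff_space Y" using Md(2) Hausdorff_space_mtopology by simp
  define small where "small n V \<longleftrightarrow> openin Y V \<and> closedin Y V \<and> (\<exists>c\<in>M. V \<subseteq> mball c (inverse (real (Suc n))))" for n V
  have "\<exists>F. finite F \<and> (\<forall>V\<in>F. small n V) \<and> \<Union>F = topspace Y" for n
  proof -
    have "y \<in> \<Union>{V. small n V}" if y: "y \<in> topspace Y" for y
    proof -
      have "openin Y (mball y (inverse (real (Suc n))))" unfolding Md(2) by (rule openin_mball)
      moreover have "y \<in> mball y (inverse (real (Suc n)))" using y top by simp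
      ultimately obtain V where "openin Y V" "closedin Y V" "y \<in> V" "V \<subseteq> mball y (inverse (real (Suc n)))"
        using clopen_neighbourhood[OF Y(1) haus Y(3)] by blast
      then show ?thesis using y top unfolding small_def by blast
    qed
    moreover have "\<Union>{V. small n V} \<subseteq> topspace Y" unfolding small_def using openin_subset by blast
    ultimately have "\<Union>{V. small n V} = topspace Y" by blast
    moreover have "\<forall>V\<in>{V. small n V}. openin Y V" unfolding small_def by simp
    ultimately obtain F where "finite F" "F \<subseteq> {V. small n V}" "\<Union>F = topspace Y"
      using Y(1) unfolding compact_space by meson
    then show ?thesis by blast
  qed
  then obtain F where F: "\<And>n. finite (F n)" "\<And>n V. V \<in> F n \<Longrightarrow> small n V" "\<And>n. \<Union>(F n) = topspace Y"
    by metis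
  \<comment> \<open>The empty set is added so that the countable family is visibly nonempty, as an
    enumeration by all natural numbers requires.\<close>
  define \<V> where "\<V> = insert {} (\<Union>n. F n)"
  have count: "countable \<V>" unfolding \<V>_def using F(1) by (auto intro: countable_finite)
  have range: "range (from_nat_into \<V>) = \<V>" using count by (intro range_from_nat_into) (auto simp: \<V>_def)
  show ?thesis
  proof
    fix i
    have "from_nat_into \<V> i \<in> \<V>" using range by blast
    then have "openin Y (from_nat_into \<V> i) \<and> closedin Y (from_nat_into \<V> i)"
      using F(2) unfolding \<V>_def small_def by auto
    then show "clopen_pred Y (\<lambda>y. y \<in> from_nat_into \<V> i)" by (intro clopen_pred_mem) auto
  next
    fix y y' assume y: "y \<in> topspace Y" "y' \<in> topspace Y" "y \<noteq> y'"
    then have "d y y' / 2 > 0" using top by simp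
    then obtain n where n: "inverse (real (Suc n)) < d y y' / 2" using reals_Archimedean by blast
    obtain V where V: "V \<in> F n" "y \<in> V" using F(3)[of n] y(1) by blast
    then obtain c where c: "c \<in> M" "V \<subseteq> mball c (inverse (real (Suc n)))" using F(2) unfolding small_def by blast
    have "y' \<notin> V"
    proof
      assume "y' \<in> V"
      then have "d c y < inverse (real (Suc n))" "d c y' < inverse (real (Suc n))" using V c by auto
      moreover have "d y y' \<le> d c y + d c y'" using triangle[of y c y'] c y top by (simp add: commute)
      ultimately show False using n by linarith
    qed
    moreover obtain i where "V = from_nat_into \<V> i" using V(1) range unfolding \<V>_def by blast
    ultimately show "\<exists>i. y \<in> from_nat_into \<V> i \<longleftrightarrow> y' \<notin> from_nat_into \<V> i" using V(2) by blast
  qed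
qed

section \<open>Bases and levels of a realization\<close>

locale kr_factor = coded_minimal_system Y S G
  for Y :: "'b topology" and S and G +
  fixes X :: "'a topology" and T :: "'a \<Rightarrow> 'a" and \<alpha> :: "'a \<Rightarrow> 'b"
    and k :: "nat \<Rightarrow> nat" and B :: "nat \<Rightarrow> nat \<Rightarrow> 'a set" and h :: "nat \<Rightarrow> nat \<Rightarrow> nat" and K :: nat
  assumes homeo_X: "homeomorphic_map X X T" and compact_X: "compact_space X" and nonempty_X: "topspace X \<noteq> {}"
    and continuous_\<alpha>: "continuous_map X Y \<alpha>"
    and equivariant_\<alpha>: "\<And>x. x \<in> topspace X \<Longrightarrow> \<alpha> (T x) = S (\<alpha> x)"
    and realization: "kr_realization X T k B h" and rank: "\<And>n. k n \<le> K"
begin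

abbreviation xiter :: "int \<Rightarrow> 'a \<Rightarrow> 'a" where
  "xiter \<equiv> int_iterate X T"

abbreviation base :: "nat \<Rightarrow> 'a set" where
  "base n \<equiv> kr_base (k n) (B n)"

abbreviation levels :: "nat \<Rightarrow> 'a set set" where
  "levels n \<equiv> kr_levels T (k n) (B n) (h n)"

lemmas xiter_in = int_iterate_in_topspace[OF homeo_X]
lemmas xiter_add = int_iterate_add[OF homeo_X]

lemma \<alpha>_in: "x \<in> topspace X \<Longrightarrow> \<alpha> x \<in> topspace Y"
  using continuous_map_image_subset_topspace[OF continuous_\<alpha>] by auto

lemma \<alpha>_xiter: "x \<in> topspace X \<Longrightarrow> \<alpha> (xiter s x) = iter s (\<alpha> x)"
  by (rule int_iterate_semiconj[OF homeo_X homeo, of \<alpha>]) (auto simp: \<alpha>_in equivariant_\<alpha>)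

lemma code_xiter: "x \<in> topspace X \<Longrightarrow> code m (\<alpha> (xiter s x)) t = code m (\<alpha> x) (t + s)"
  using code_iter[OF \<alpha>_in] by (simp add: \<alpha>_xiter)

lemma xiter_inverse: "x \<in> topspace X \<Longrightarrow> xiter (- s) (xiter s x) = x" "x \<in> topspace X \<Longrightarrow> xiter s (xiter (- s) x) = x"
  using xiter_add[of x "- s" s] xiter_add[of x s "- s"] by simp_all

lemma kr_partition: "kr_partition X T (k n) (B n) (h n)"
  using realization unfolding kr_realization_def by blast

lemma h_pos: "i < k n \<Longrightarrow> h n i > 0"
  using kr_partition[of n] unfolding kr_partition_def by (auto simp: Suc_le_eq)

lemma levelsI: "i < k n \<Longrightarrow> j < h n i \<Longrightarrow> (T ^^ j) ` B n i \<in> levels n"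
  unfolding kr_levels_def by blast

lemma level_clopen: "U \<in> levels n \<Longrightarrow> openin X U \<and> closedin X U" and level_nonempty: "U \<in> levels n \<Longrightarrow> U \<noteq> {}"
  using kr_partition[of n] unfolding kr_partition_def by blast+

lemma Union_levels: "\<Union>(levels n) = topspace X"
  using kr_partition[of n] unfolding kr_partition_def by blast

lemma B_clopen: "i < k n \<Longrightarrow> openin X (B n i) \<and> closedin X (B n i)"
  and B_nonempty: "i < k n \<Longrightarrow> B n i \<noteq> {}"
  using levelsI[OF _ h_pos, of i n] level_clopen[of "B n i" n] level_nonempty[of "B n i" n] by auto

lemma B_topspace: "i < k n \<Longrightarrow> x \<in> B n i \<Longrightarrow> x \<in> topspace X"
  using B_clopen openin_subset by blast

lemma base_clopen: "openin X (base n) \<and> closedin X (base n)"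
proof
  show "openin X (base n)" unfolding kr_base_def using B_clopen by (intro openin_Union) auto
  show "closedin X (base n)" unfolding kr_base_def using B_clopen by (intro closedin_Union) auto
qed

lemma base_topspace: "x \<in> base n \<Longrightarrow> x \<in> topspace X"
  unfolding kr_base_def using B_topspace by auto

lemma baseI: "i < k n \<Longrightarrow> x \<in> B n i \<Longrightarrow> x \<in> base n"
  unfolding kr_base_def by auto

lemma level_unique:
  assumes "i < k n" "j < h n i" "b \<in> B n i" "i' < k n" "j' < h n i'" "b' \<in> B n i'"
    and eq: "xiter (int j) b = xiter (int j') b'"
  shows "i = i' \<and> j = j'"
proof (rule ccontr)
  assume "\<not> ?thesis"
  moreover have "disjoint_family_on (\<lambda>(i, j). (T ^^ j) ` B n i) (SIGMA i:{..<k n}. {..<h n i})"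
    using kr_partition[of n] unfolding kr_partition_def by blast
  ultimately have "(T ^^ j) ` B n i \<inter> (T ^^ j') ` B n i' = {}"
    using assms(1,2,4,5) disjoint_family_onD[of _ _ "(i, j)" "(i', j')"] by fastforce
  moreover have "(T ^^ j) b = (T ^^ j') b'" using eq by (simp add: int_iterate_int)
  ultimately show False using assms(3,6) by blast
qed

lemma tower_position:
  assumes "x \<in> topspace X"
  obtains i j where "i < k n" "j < h n i" "xiter (- int j) x \<in> B n i"
proof -
  obtain U where "U \<in> levels n" "x \<in> U" using assms Union_levels[of n] by blast
  then obtain i j b where ij: "i < k n" "j < h n i" "b \<in> B n i" "x = (T ^^ j) b" unfolding kr_levels_def by auto
  then have "x = xiter (int j) b" by (simp add: int_iterate_int)
  then have "xiter (- int j) x = b" using xiter_inverse(1) B_topspace ij by simp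
  then show ?thesis using ij that by blast
qed

text \<open>If the point above the top of tower \<open>i\<close> were at level \<open>j > 0\<close>
  of tower \<open>i'\<close>, its predecessor would be at level \<open>j - 1\<close> there and at
  the top of tower \<open>i\<close>. Disjointness then gives \<open>j = h n i\<close>, which is not
  a level.\<close>

lemma return_to_base:
  assumes i: "i < k n" and x: "x \<in> B n i"
  shows "xiter (int (h n i)) x \<in> base n"
proof -
  have xX: "x \<in> topspace X" using B_topspace i x .
  obtain i' j where ij: "i' < k n" "j < h n i'" "xiter (- int j) (xiter (int (h n i)) x) \<in> B n i'"
    using tower_position[OF xiter_in[OF xX]] .
  have b: "xiter (int (h n i) - int j) x \<in> B n i'"
    using ij(3) xiter_add[OF xX, of "- int j" "int (h n i)"] by simp
  have "j = 0"
  proof (rule ccontr)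
    assume "j \<noteq> 0"
    have "xiter (int (h n i - 1)) x = xiter (int (j - 1)) (xiter (int (h n i) - int j) x)"
      using \<open>j \<noteq> 0\<close> h_pos[OF i] xiter_add[OF xX, of "int (j - 1)" "int (h n i) - int j"]
      by (simp add: of_nat_diff)
    moreover have "h n i - 1 < h n i" using h_pos[OF i] by simp
    moreover have "j - 1 < h n i'" using ij(2) by simp
    ultimately have "i = i' \<and> h n i - 1 = j - 1" using level_unique i x ij(1) b by blast
    then have "h n i = j" using \<open>j \<noteq> 0\<close> h_pos[OF i] by linarith
    then show False using ij(2) \<open>i = i' \<and> _\<close> by simp
  qed
  then show ?thesis using b ij(1) by (auto intro: baseI)
qed

text \<open>The predecessor of a base point is at the top of its tower, since otherwise the base
  point would also lie at a positive level.\<close>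

lemma previous_base:
  assumes x: "x \<in> base n"
  obtains i where "i < k n" "xiter (- int (h n i)) x \<in> B n i"
proof -
  have xX: "x \<in> topspace X" using base_topspace x .
  obtain i j where ij: "i < k n" "j < h n i" "xiter (- int j) (xiter (- 1) x) \<in> B n i"
    using tower_position[OF xiter_in[OF xX]] .
  have b: "xiter (- int (Suc j)) x \<in> B n i"
    using ij(3) xiter_add[OF xX, of "- int j" "- 1"] by (simp add: algebra_simps)
  have "Suc j = h n i"
  proof (rule ccontr)
    assume "Suc j \<noteq> h n i"
    then have "Suc j < h n i" using ij(2) by simp
    obtain i' where i': "i' < k n" "x \<in> B n i'" using x unfolding kr_base_def by blast
    have "xiter (int 0) x = xiter (int (Suc j)) (xiter (- int (Suc j)) x)"
      using xiter_inverse(2)[OF xX, of "int (Suc j)"] by simp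
    then show False using level_unique[OF i'(1) h_pos[OF i'(1)] i'(2) ij(1) \<open>Suc j < h n i\<close> b] by simp
  qed
  then show ?thesis using that[OF ij(1)] b by simp
qed

lemma base_mono: "n \<le> n' \<Longrightarrow> base n' \<subseteq> base n"
proof (induction n' rule: dec_induct)
  case (step n')
  have "base (Suc n') \<subseteq> base n'" using realization unfolding kr_realization_def by blast
  then show ?case using step by blast
qed simp

lemma levels_refine: "n \<le> n' \<Longrightarrow> U \<in> levels n' \<Longrightarrow> \<exists>V\<in>levels n. U \<subseteq> V"
proof (induction n' arbitrary: U rule: dec_induct)
  case base
  then show ?case by (intro bexI[of _ U]) simp_all
next
  case (step n')
  have "\<forall>U\<in>levels (Suc n'). \<exists>V\<in>levels n'. U \<subseteq> V"
    using realization unfolding kr_realization_def by (elim conjE allE)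
  from bspec[OF this step.prems] obtain V where V: "V \<in> levels n'" "U \<subseteq> V" ..
  from step.IH[OF V(1)] obtain W where "W \<in> levels n" "V \<subseteq> W" ..
  then show ?case using V(2) by (intro bexI[of _ W] order_trans[of U V W])
qed

lemma levels_disjoint:
  assumes "U \<in> levels n" "V \<in> levels n" "x \<in> U" "x \<in> V"
  shows "U = V"
proof -
  obtain i j b where 1: "i < k n" "j < h n i" "b \<in> B n i" "x = (T ^^ j) b" "U = (T ^^ j) ` B n i"
    using assms(1,3) unfolding kr_levels_def by auto
  obtain i' j' b' where 2: "i' < k n" "j' < h n i'" "b' \<in> B n i'" "x = (T ^^ j') b'" "V = (T ^^ j') ` B n i'"
    using assms(2,4) unfolding kr_levels_def by auto
  have "i = i' \<and> j = j'"
    using level_unique[OF 1(1-3) 2(1-3)] 1(4) 2(4) by (simp add: int_iterate_int)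
  then show ?thesis using 1(5) 2(5) by simp
qed

text \<open>By induction on the generation of \<open>U\<close>: a generator is itself a level, and
  for an intersection a later partition refines both earlier ones.\<close>

lemma level_inside_open:
  assumes "openin X U" "x \<in> U"
  shows "\<exists>n. \<forall>V\<in>levels n. x \<in> V \<longrightarrow> V \<subseteq> U"
proof -
  have "topology_generated_by (\<Union>n. levels n) = X" using realization unfolding kr_realization_def by blast
  then have "generate_topology_on (\<Union>n. levels n) U" using assms(1) openin_topology_generated_by by metis
  then show ?thesis using assms(2)
  proof (induction U)
    case (Int U U')
    from Int.IH(1)[OF IntD1[OF Int.prems]] obtain n where n: "\<forall>V\<in>levels n. x \<in> V \<longrightarrow> V \<subseteq> U" ..
    from Int.IH(2)[OF IntD2[OF Int.prems]] obtain n' where n': "\<forall>V\<in>levels n'. x \<in> V \<longrightarrow> V \<subseteq> U'" ..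
    show ?case
    proof (intro exI ballI impI)
      fix V assume V: "V \<in> levels (max n n')" "x \<in> V"
      obtain W where W: "W \<in> levels n" "V \<subseteq> W"
        using levels_refine[OF max.cobounded1 V(1)] by (elim bexE)
      obtain W' where W': "W' \<in> levels n'" "V \<subseteq> W'"
        using levels_refine[OF max.cobounded2 V(1)] by (elim bexE)
      have "W \<subseteq> U" using n W(1) subsetD[OF W(2) V(2)] by simp
      moreover have "W' \<subseteq> U'" using n' W'(1) subsetD[OF W'(2) V(2)] by simp
      ultimately show "V \<subseteq> U \<inter> U'" using W(2) W'(2) by (intro Int_greatest; order)
    qed
  next
    case (UN F)
    from UN.prems obtain U where U: "U \<in> F" "x \<in> U" by (elim UnionE)
    from UN.IH[OF this] obtain n where n: "\<forall>V\<in>levels n. x \<in> V \<longrightarrow> V \<subseteq> U" ..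
    show ?case using n Union_upper[OF U(1)] by (intro exI[of _ n] ballI impI) (simp add: order_trans[of _ U])
  next
    case (Basis U)
    from Basis(1) obtain n where n: "U \<in> levels n" by (elim UN_E)
    have "V \<subseteq> U" if "V \<in> levels n" "x \<in> V" for V
      using levels_disjoint[OF n that(1) Basis(2) that(2)] by simp
    then show ?case by (intro exI[of _ n] ballI impI)
  qed simp
qed

text \<open>By compactness finitely many levels on which \<open>P\<close> is constant cover
  \<open>X\<close>. Beyond the last of their stages every level is contained in one of them.\<close>

lemma levels_decide:
  assumes P: "clopen_pred X P"
  shows "\<exists>n0. \<forall>n\<ge>n0. \<forall>U\<in>levels n. (\<forall>x\<in>U. P x) \<or> (\<forall>x\<in>U. \<not> P x)"
proof -
  define dec where "dec U \<longleftrightarrow> (\<forall>x\<in>U. P x) \<or> (\<forall>x\<in>U. \<not> P x)" for U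
  let ?\<U> = "{U. \<exists>n. U \<in> levels n \<and> dec U}"
  have "x \<in> \<Union>?\<U>" if x: "x \<in> topspace X" for x
  proof -
    define Q where "Q = {y \<in> topspace X. P y \<longleftrightarrow> P x}"
    have "openin X Q"
      using clopen_predD(1)[OF P] clopen_predD(1)[OF clopen_pred_not[OF P]] unfolding Q_def by (cases "P x") auto
    then obtain n where n: "\<forall>V\<in>levels n. x \<in> V \<longrightarrow> V \<subseteq> Q" using level_inside_open[of Q x] x unfolding Q_def by blast
    obtain V where V: "V \<in> levels n" "x \<in> V" using Union_levels[of n] x by blast
    then have "V \<subseteq> Q" using n by blast
    then have "dec V" unfolding dec_def Q_def by blast
    then show ?thesis using V by blast
  qed
  moreover have "\<Union>?\<U> \<subseteq> topspace X" using Union_levels by blast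
  ultimately have "\<Union>?\<U> = topspace X" by blast
  moreover have "\<forall>U\<in>?\<U>. openin X U" using level_clopen by blast
  ultimately obtain F where F: "finite F" "F \<subseteq> ?\<U>" "\<Union>F = topspace X"
    using compact_X unfolding compact_space by meson
  have "\<forall>U\<in>F. \<exists>n. U \<in> levels n \<and> dec U" using F(2) by blast
  from bchoice[OF this] obtain m where m: "\<And>U. U \<in> F \<Longrightarrow> U \<in> levels (m U) \<and> dec U" by blast
  define n0 where "n0 = Max (insert 0 (m ` F))"
  have n0: "m U \<le> n0" if "U \<in> F" for U unfolding n0_def using F(1) that by (intro Max_ge) auto
  show ?thesis
  proof (intro exI[of _ n0] allI impI ballI)
    fix n U assume n: "n0 \<le> n" and U: "U \<in> levels n"
    obtain x where x: "x \<in> U" using level_nonempty[OF U] by blast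
    then have "x \<in> topspace X" using U Union_levels[of n] by blast
    then obtain V where V: "V \<in> F" "x \<in> V" using F(3) by blast
    obtain V' where V': "V' \<in> levels (m V)" "U \<subseteq> V'" using levels_refine[OF _ U] n0[OF V(1)] n by (meson le_trans)
    have "V' = V" using levels_disjoint[OF V'(1)] m[OF V(1)] V'(2) V(2) x by blast
    then have "U \<subseteq> V" "dec V" using V' m[OF V(1)] by auto
    then show "(\<forall>x\<in>U. P x) \<or> (\<forall>x\<in>U. \<not> P x)" unfolding dec_def by blast
  qed
qed

section \<open>Tower words and the parses they give\<close>

definition tower_word :: "nat \<Rightarrow> nat \<Rightarrow> nat \<Rightarrow> 'a \<Rightarrow> nat set list" where
  "tower_word n m i x = map (\<lambda>j. code m (\<alpha> x) (int j)) [0..<h n i]"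

definition words :: "nat \<Rightarrow> nat \<Rightarrow> nat set list set" where
  "words n m = {tower_word n m i x |i x. i < k n \<and> x \<in> B n i}"

definition determined :: "nat \<Rightarrow> nat \<Rightarrow> bool" where
  "determined n m \<longleftrightarrow> (\<forall>i<k n. \<forall>x\<in>B n i. \<forall>x'\<in>B n i. tower_word n m i x = tower_word n m i x')"

text \<open>There are finitely many letters, and \<open>levels_decide\<close> applies to the
  occurrence of each; beyond the largest stage the letter at position 0 is constant on every
  level.\<close>

lemma eventually_determined: "\<exists>n0. \<forall>n\<ge>n0. determined n m"
proof -
  have "\<forall>A\<in>Pow {..<m}. \<exists>n0. \<forall>n\<ge>n0. \<forall>U\<in>levels n.
      (\<forall>x\<in>U. code m (\<alpha> x) 0 = A) \<or> (\<forall>x\<in>U. code m (\<alpha> x) 0 \<noteq> A)"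
    by (intro ballI levels_decide clopen_pred_compose[OF continuous_\<alpha> clopen_code_eq])
  from bchoice[OF this] obtain N where N: "\<And>A n U x x'. A \<subseteq> {..<m} \<Longrightarrow> N A \<le> n \<Longrightarrow> U \<in> levels n \<Longrightarrow>
      x \<in> U \<Longrightarrow> x' \<in> U \<Longrightarrow> code m (\<alpha> x) 0 = A \<Longrightarrow> code m (\<alpha> x') 0 = A"
    by (metis Pow_iff)
  define n0 where "n0 = Max (N ` Pow {..<m})"
  have n0: "N A \<le> n0" if "A \<subseteq> {..<m}" for A unfolding n0_def using that by (intro Max_ge) auto
  show ?thesis
  proof (intro exI[of _ n0] allI impI)
    fix n assume n: "n0 \<le> n"
    have eq: "code m (\<alpha> x) (int j) = code m (\<alpha> x') (int j)"
      if i: "i < k n" "j < h n i" and x: "x \<in> B n i" "x' \<in> B n i" for i j x x'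
    proof -
      let ?A = "code m (\<alpha> (xiter (int j) x)) 0"
      have A: "?A \<subseteq> {..<m}" by (rule code_subset)
      have "xiter (int j) x \<in> (T ^^ j) ` B n i" "xiter (int j) x' \<in> (T ^^ j) ` B n i"
        using x by (auto simp: int_iterate_int)
      then have "code m (\<alpha> (xiter (int j) x')) 0 = ?A"
        using N[OF A le_trans[OF n0[OF A] n] levelsI[OF i]] by blast
      then show ?thesis using code_xiter B_topspace i x by simp
    qed
    show "determined n m"
      unfolding determined_def tower_word_def by (intro allI impI ballI map_cong refl eq) simp_all
  qed
qed

lemma words_restrict: "m \<le> m' \<Longrightarrow> map (\<lambda>A. A \<inter> {..<m}) ` words n m' = words n m"
proof -
  assume "m \<le> m'"
  then have "map (\<lambda>A. A \<inter> {..<m}) (tower_word n m' i x) = tower_word n m i x" for i x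
    unfolding tower_word_def using code_restrict[of m m'] by simp
  then show ?thesis unfolding words_def by (auto simp: image_iff) metis+
qed

lemma Nil_notin_words: "[] \<notin> words n m"
  unfolding words_def tower_word_def using h_pos by fastforce

lemma words_nonempty: "words n m \<noteq> {}"
proof -
  obtain x where "x \<in> topspace X" using nonempty_X by blast
  then obtain i j where "i < k n" "xiter (- int j) x \<in> B n i" using tower_position by metis
  then show ?thesis unfolding words_def by blast
qed

lemma rank_le_words:
  assumes "determined n m"
  shows "rank_le (words n m) K"
proof -
  have "words n m = (\<lambda>i. tower_word n m i (SOME x. x \<in> B n i)) ` {..<k n}"
  proof (intro set_eqI iffI)
    fix w assume "w \<in> words n m"
    then obtain i x where i: "i < k n" "x \<in> B n i" "w = tower_word n m i x" unfolding words_def by blast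
    then have "w = tower_word n m i (SOME x. x \<in> B n i)"
      using assms someI[of "\<lambda>x. x \<in> B n i" x] unfolding determined_def by blast
    then show "w \<in> (\<lambda>i. tower_word n m i (SOME x. x \<in> B n i)) ` {..<k n}" using i by blast
  next
    fix w assume "w \<in> (\<lambda>i. tower_word n m i (SOME x. x \<in> B n i)) ` {..<k n}"
    then obtain i where i: "i < k n" "w = tower_word n m i (SOME x. x \<in> B n i)" by blast
    then have "(SOME x. x \<in> B n i) \<in> B n i" using B_nonempty some_in_eq by blast
    then show "w \<in> words n m" unfolding words_def using i by blast
  qed
  then have "finite (words n m)" "card (words n m) \<le> K"
    using card_image_le[of "{..<k n}"] rank[of n] by (simp, metis card_lessThan finite_lessThan le_trans)
  then show ?thesis unfolding rank_le_def using Nil_notin_words star_incl by (meson subsetI)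
qed

lemma tower_word_occurs:
  assumes "x \<in> topspace X"
  shows "occurs (code m (\<alpha> x)) s (tower_word n m i (xiter s x))"
  unfolding occurs_def tower_word_def using assms by (simp add: code_xiter add.commute)

lemma parses_right:
  assumes x: "x \<in> topspace X" and s: "xiter s x \<in> base n"
  shows "parses (words n m) (code m (\<alpha> x)) s"
  using s
proof (coinduction arbitrary: s)
  case (parses s)
  then obtain i where i: "i < k n" "xiter s x \<in> B n i" unfolding kr_base_def by blast
  have "xiter (s + int (h n i)) x \<in> base n"
    using return_to_base[OF i] xiter_add[OF x, of "int (h n i)" s] by (simp add: add.commute)
  then show ?case
    using i tower_word_occurs[OF x, of m s n i]
    by (intro exI[of _ "tower_word n m i (xiter s x)"] exI[of _ s]) (auto simp: words_def tower_word_def)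
qed

text \<open>The tower word ending just before the visit \<open>s\<close>, supplied by
  \<open>previous_base\<close>, is read backwards and becomes the first word of the reflected code
  after \<open>- s\<close>.\<close>

lemma parses_left:
  assumes x: "x \<in> topspace X" and s: "xiter s x \<in> base n"
  shows "parses (rev ` words n m) (reflect (code m (\<alpha> x))) (- s)"
  using s
proof (coinduction arbitrary: s)
  case (parses s)
  then obtain i where i: "i < k n" "xiter (- int (h n i)) (xiter s x) \<in> B n i" using previous_base by blast
  let ?s = "s - int (h n i)"
  let ?w = "tower_word n m i (xiter ?s x)"
  have B: "xiter ?s x \<in> B n i" using i(2) xiter_add[OF x, of "- int (h n i)" s] by simp
  have len: "length ?w = h n i" unfolding tower_word_def by simp
  have "occurs (reflect (code m (\<alpha> x))) (- (?s + int (length ?w))) (rev ?w)"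
    by (rule occurs_reflect[OF tower_word_occurs[OF x]])
  then have "occurs (reflect (code m (\<alpha> x))) (- s) (rev ?w)" using len by simp
  moreover have "rev ?w \<in> rev ` words n m" unfolding words_def using i(1) B by blast
  moreover have "xiter ?s x \<in> base n" using baseI[OF i(1) B] .
  moreover have "- s + int (length (rev ?w)) = - ?s" using len by simp
  ultimately show ?case
    by (intro exI[of _ "rev ?w"] exI[of _ "- s"] conjI disjI1 exI[of _ ?s]) auto
qed

section \<open>Families of points without common cuts\<close>

definition no_common_cut :: "nat \<Rightarrow> 'a \<Rightarrow> 'a \<Rightarrow> bool" where
  "no_common_cut n x x' \<longleftrightarrow> (\<forall>t. \<not> (xiter t x \<in> base n \<and> xiter t x' \<in> base n))"

definition spread :: "nat \<Rightarrow> nat \<Rightarrow> nat \<Rightarrow> (nat \<Rightarrow> 'a) \<Rightarrow> bool" where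
  "spread n m q f \<longleftrightarrow> (\<forall>a<q. f a \<in> topspace X) \<and>
     (\<forall>a<q. \<forall>b<q. code m (\<alpha> (f a)) = code m (\<alpha> (f b)) \<and> (a \<noteq> b \<longrightarrow> no_common_cut n (f a) (f b)))"

lemma spread_mono:
  assumes "spread n m q f" "n \<le> n'" "m' \<le> m"
  shows "spread n' m' q f"
proof -
  show ?thesis
    unfolding spread_def
  proof (intro conjI allI impI)
    show "f a \<in> topspace X" if "a < q" for a using assms(1) that unfolding spread_def by blast
    fix a b assume ab: "a < q" "b < q"
    show "code m' (\<alpha> (f a)) = code m' (\<alpha> (f b))"
      using assms(1) ab unfolding spread_def by (intro code_eq_mono[OF _ assms(3)]) blast
    assume "a \<noteq> b"
    then have "no_common_cut n (f a) (f b)" using assms(1) ab unfolding spread_def by blast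
    then show "no_common_cut n' (f a) (f b)"
      using base_mono[OF assms(2)] unfolding no_common_cut_def by blast
  qed
qed

text \<open>For each position \<open>e\<close>, let \<open>s e a\<close> be the start of the tower
  block of \<open>f a\<close> that covers \<open>e\<close>. Equal starts would be a common cut, so
  the shared code contains \<open>L\<close> tower words around \<open>e\<close> with distinct
  starts, as \<open>many_parses_imp_periodic\<close> requires.\<close>

lemma spread_bounded:
  assumes det: "determined n m" and f: "spread n m q f" and L: "L = K * (2 * (2 ^ K + 1)) + 1" "L \<le> q"
  shows "\<exists>p>0. \<forall>t. code m (\<alpha> (f 0)) t = code m (\<alpha> (f 0)) (t + p)"
proof -
  have in_X: "f a \<in> topspace X" if "a < L" for a using f that L(2) unfolding spread_def by simp
  define starts where "starts e a s \<longleftrightarrow> (\<exists>i. i < k n \<and> xiter s (f a) \<in> B n i \<and> s \<le> e \<and> e < s + int (h n i))" for e a s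
  define s where "s e a = (SOME s. starts e a s)" for e a
  have s: "starts e a (s e a)" if a: "a < L" for e a
    unfolding s_def
  proof (rule someI_ex)
    obtain i j where ij: "i < k n" "j < h n i" "xiter (- int j) (xiter e (f a)) \<in> B n i"
      using tower_position[OF xiter_in[OF in_X[OF a]]] .
    then show "\<exists>s. starts e a s" using xiter_add[OF in_X[OF a], of "- int j" e]
      unfolding starts_def by (intro exI[of _ "e - int j"] exI[of _ i]) simp
  qed
  define w where "w i = tower_word n m i (SOME x. x \<in> B n i)" for i
  show ?thesis
  proof (rule many_parses_imp_periodic[OF rank[of n] L(1), of _ s w])
    fix e a assume a: "a < L"
    obtain i where i: "i < k n" "xiter (s e a) (f a) \<in> B n i" "s e a \<le> e" "e < s e a + int (h n i)"
      using s[OF a, of e] unfolding starts_def by (elim exE conjE)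
    have "(SOME x. x \<in> B n i) \<in> B n i" using i(2) by (rule someI)
    then have "w i = tower_word n m i (xiter (s e a) (f a))" unfolding w_def using det i(1,2) unfolding determined_def by blast
    then have "occurs (code m (\<alpha> (f a))) (s e a) (w i)" using tower_word_occurs[OF in_X[OF a]] by simp
    moreover have "code m (\<alpha> (f a)) = code m (\<alpha> (f 0))"
    proof -
      have "a < q" "0 < q" using a L(2) by simp_all
      then show ?thesis using f unfolding spread_def by blast
    qed
    moreover have "length (w i) = h n i" unfolding w_def tower_word_def by simp
    ultimately show "\<exists>i<k n. occurs (code m (\<alpha> (f 0))) (s e a) (w i) \<and> s e a \<le> e \<and> e < s e a + int (length (w i))"
      using i by auto
  next
    fix e show "inj_on (s e) {..<L}"
    proof (rule inj_onI, rule ccontr)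
      fix a b assume ab: "a \<in> {..<L}" "b \<in> {..<L}" "s e a = s e b" "a \<noteq> b"
      have "xiter (s e a) (f a) \<in> base n" "xiter (s e b) (f b) \<in> base n"
        using s[of a e] s[of b e] ab(1,2) baseI unfolding starts_def by auto
      moreover have "no_common_cut n (f a) (f b)" using f ab L(2) unfolding spread_def by simp
      ultimately show False using ab(3) unfolding no_common_cut_def by metis
    qed
  qed
qed

text \<open>
  The spread families form a closed invariant subset of a power of \<open>X\<close>, so their projection to \<open>Y\<close> is
  closed and invariant.
\<close>

lemma spread_over:
  assumes f: "spread n m q f" and q: "q > 0" and y: "y \<in> topspace Y"
  shows "\<exists>g. spread n m q g \<and> \<alpha> (g 0) = y"
proof -
  let ?P = "product_topology (\<lambda>_. X) {..<q}"
  \<comment> \<open>The conditions at one time \<open>t\<close>, with equality of letters written as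
    a finite disjunction, so that each is clopen by the rules above and \<open>Q\<close> is
    closed.\<close>
  define ok where "ok f t \<longleftrightarrow> (\<forall>a\<in>{..<q}. \<forall>b\<in>{..<q}.
    (\<exists>A\<in>Pow {..<m}. code m (\<alpha> (f a)) t = A \<and> code m (\<alpha> (f b)) t = A) \<and>
    (a = b \<or> \<not> (xiter t (f a) \<in> base n \<and> xiter t (f b) \<in> base n)))" for f t
  define Q where "Q = {f \<in> topspace ?P. \<forall>t. ok f t}"
  have code_eq: "(\<exists>A\<in>Pow {..<m}. code m u t = A \<and> code m v t = A) \<longleftrightarrow> code m u t = code m v t" for u v t
    using code_subset[of m u t] by (intro iffI bexI[of _ "code m u t"]) (elim bexE conjE, simp_all)
  have ok_iff: "(\<forall>t. ok f t) \<longleftrightarrow> (\<forall>a<q. \<forall>b<q. code m (\<alpha> (f a)) = code m (\<alpha> (f b)) \<and> (a \<noteq> b \<longrightarrow> no_common_cut n (f a) (f b)))" for f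
  proof
    assume *: "\<forall>t. ok f t"
    show "\<forall>a<q. \<forall>b<q. code m (\<alpha> (f a)) = code m (\<alpha> (f b)) \<and> (a \<noteq> b \<longrightarrow> no_common_cut n (f a) (f b))"
    proof (intro allI impI conjI)
      fix a b assume ab: "a < q" "b < q"
      have ok: "code m (\<alpha> (f a)) t = code m (\<alpha> (f b)) t \<and>
          (a = b \<or> \<not> (xiter t (f a) \<in> base n \<and> xiter t (f b) \<in> base n))" for t
        using spec[OF *, of t] ab unfolding ok_def code_eq by blast
      show "code m (\<alpha> (f a)) = code m (\<alpha> (f b))" by (rule ext) (rule conjunct1[OF ok])
      assume "a \<noteq> b"
      then show "no_common_cut n (f a) (f b)"
        unfolding no_common_cut_def using conjunct2[OF ok] by blast
    qed
  next
    assume *: "\<forall>a<q. \<forall>b<q. code m (\<alpha> (f a)) = code m (\<alpha> (f b)) \<and> (a \<noteq> b \<longrightarrow> no_common_cut n (f a) (f b))"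
    show "\<forall>t. ok f t"
      unfolding ok_def code_eq
    proof (intro allI ballI conjI)
      fix t a b assume ab: "a \<in> {..<q}" "b \<in> {..<q}"
      then have "code m (\<alpha> (f a)) = code m (\<alpha> (f b))" using * by blast
      then show "code m (\<alpha> (f a)) t = code m (\<alpha> (f b)) t" by simp
      have "a \<noteq> b \<longrightarrow> no_common_cut n (f a) (f b)" using * ab by blast
      then show "a = b \<or> \<not> (xiter t (f a) \<in> base n \<and> xiter t (f b) \<in> base n)"
        unfolding no_common_cut_def by blast
    qed
  qed
  have spreadI: "spread n m q g" if "g \<in> Q" for g
  proof -
    have "\<forall>a<q. g a \<in> topspace X" using that unfolding Q_def by (auto simp: PiE_iff)
    moreover have "\<forall>t. ok g t" using that unfolding Q_def by simp
    ultimately show ?thesis unfolding spread_def ok_iff by (rule conjI)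
  qed
  \<comment> \<open>Points of the product topology are undefined outside the index set, hence the
    \<open>restrict\<close>.\<close>
  have Q_I: "restrict g {..<q} \<in> Q" if "spread n m q g" for g
  proof -
    have "restrict g {..<q} \<in> topspace ?P" using that unfolding spread_def by auto
    moreover have "\<forall>t. ok (restrict g {..<q}) t"
      unfolding ok_iff
    proof (intro allI impI)
      fix a b assume ab: "a < q" "b < q"
      then have eq: "restrict g {..<q} a = g a" "restrict g {..<q} b = g b" by simp_all
      show "code m (\<alpha> (restrict g {..<q} a)) = code m (\<alpha> (restrict g {..<q} b)) \<and>
          (a \<noteq> b \<longrightarrow> no_common_cut n (restrict g {..<q} a) (restrict g {..<q} b))"
        unfolding eq using that ab unfolding spread_def by blast
    qed
    ultimately show ?thesis unfolding Q_def by simp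
  qed
  have proj: "continuous_map ?P X (\<lambda>f. f a)" if "a < q" for a
    using that by (intro continuous_map_product_projection) simp
  have cont_t: "continuous_map ?P X (\<lambda>f. xiter t (f a))" if "a < q" for a t
    using continuous_map_compose[OF proj[OF that] continuous_map_int_iterate[OF homeo_X, of t]] by (simp add: comp_def)
  have cont_\<alpha>: "continuous_map ?P Y (\<lambda>f. \<alpha> (f a))" if "a < q" for a
    using continuous_map_compose[OF proj[OF that] continuous_\<alpha>] by (simp add: comp_def)
  have "clopen_pred ?P (\<lambda>f. ok f t)" for t
    unfolding ok_def
  proof (intro clopen_pred_ball finite_lessThan clopen_pred_conj clopen_pred_bex)
    fix a b assume ab: "a \<in> {..<q}" "b \<in> {..<q}"
    show "clopen_pred ?P (\<lambda>f. code m (\<alpha> (f a)) t = A)" "clopen_pred ?P (\<lambda>f. code m (\<alpha> (f b)) t = A)" for A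
      using ab by (auto intro!: clopen_pred_compose[OF cont_\<alpha> clopen_code_eq])
    have base: "clopen_pred ?P (\<lambda>f. xiter t (f c) \<in> base n)" if "c < q" for c
      using base_clopen by (intro clopen_pred_compose[OF cont_t[OF that] clopen_pred_mem]) auto
    have *: "clopen_pred ?P (\<lambda>f. \<not> (xiter t (f a) \<in> base n \<and> xiter t (f b) \<in> base n))"
      using ab by (intro clopen_pred_not clopen_pred_conj base) auto
    have "clopen_pred ?P (\<lambda>_. True)" using clopen_pred_ball[of "{} :: nat set" ?P] by simp
    with * show "clopen_pred ?P (\<lambda>f. a = b \<or> \<not> (xiter t (f a) \<in> base n \<and> xiter t (f b) \<in> base n))"
      by (cases "a = b") simp_all
  qed simp
  then have "closedin ?P Q" unfolding Q_def by (rule closedin_all_clopen)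
  moreover have "compact_space ?P" using compact_X by (simp add: compact_space_product_topology)
  ultimately have "compactin ?P Q" by (intro closedin_compact_space)
  then have "compactin Y ((\<lambda>f. \<alpha> (f 0)) ` Q)" by (rule image_compactin[OF _ cont_\<alpha>[OF q]])
  then have "closedin Y ((\<lambda>f. \<alpha> (f 0)) ` Q)" using Hausdorff by (intro compactin_imp_closedin)
  moreover have "(\<lambda>f. \<alpha> (f 0)) ` Q \<noteq> {}" using Q_I[OF f] by blast
  moreover have "iter t y \<in> (\<lambda>f. \<alpha> (f 0)) ` Q" if y_in: "y \<in> (\<lambda>f. \<alpha> (f 0)) ` Q" for y t
  proof -
    obtain g where g: "g \<in> Q" "y = \<alpha> (g 0)" using y_in by blast
    note sp = spreadI[OF g(1)]
    have gX: "g a \<in> topspace X" if "a < q" for a using sp that unfolding spread_def by blast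
    let ?g = "\<lambda>a. xiter t (g a)"
    have code_g: "code m (\<alpha> (?g a)) = code m (\<alpha> (?g b))" if "a < q" "b < q" for a b
    proof (rule ext)
      have "code m (\<alpha> (g a)) = code m (\<alpha> (g b))" using sp that unfolding spread_def by blast
      then show "code m (\<alpha> (?g a)) u = code m (\<alpha> (?g b)) u" for u
        by (simp only: code_xiter gX that)
    qed
    have cut_g: "no_common_cut n (?g a) (?g b)" if "a < q" "b < q" "a \<noteq> b" for a b
    proof -
      have "no_common_cut n (g a) (g b)" using sp that unfolding spread_def by blast
      then show ?thesis unfolding no_common_cut_def
        using xiter_add[OF gX[OF that(1)], symmetric] xiter_add[OF gX[OF that(2)], symmetric] by simp
    qed
    have "spread n m q ?g"
      unfolding spread_def by (intro conjI allI impI xiter_in gX code_g cut_g)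
    then have "restrict ?g {..<q} \<in> Q" by (rule Q_I)
    moreover have "\<alpha> (restrict ?g {..<q} 0) = iter t y"
      using q g(2) \<alpha>_xiter[OF gX[OF q]] by simp
    ultimately show ?thesis by (metis (no_types, lifting) image_eqI)
  qed
  ultimately have "(\<lambda>f. \<alpha> (f 0)) ` Q = topspace Y" by (rule invariant_closed_eq)
  then have "y \<in> (\<lambda>f. \<alpha> (f 0)) ` Q" using y by (simp only:)
  then show ?thesis using spreadI by blast
qed

lemma spread_one: "x \<in> topspace X \<Longrightarrow> spread n m 1 (\<lambda>_. x)"
  unfolding spread_def by simp

text \<open>A single point is a spread family, so this is the case \<open>q = 1\<close> of
  \<open>spread_over\<close>.\<close>

lemma \<alpha>_surj:
  assumes "y \<in> topspace Y"
  shows "\<exists>x\<in>topspace X. \<alpha> x = y"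
proof -
  obtain x where x: "x \<in> topspace X" using nonempty_X by blast
  obtain g where "spread 0 0 1 g" "\<alpha> (g 0) = y"
    using spread_over[OF spread_one[OF x, of 0 0] zero_less_one assms] by blast
  then show ?thesis unfolding spread_def by (intro bexI[of _ "g 0"]) simp_all
qed

text \<open>Place a family with a common \<open>m'\<close>-code over \<open>y\<close> and append a
  preimage of \<open>y'\<close>. All \<open>q + 1\<close> points share the \<open>m\<close>-code, so
  by \<open>max\<close> the new point has a common cut with an old one, and their
  \<open>m'\<close>-codes are those of \<open>y'\<close> and \<open>y\<close>.\<close>

lemma common_cut:
  assumes max: "\<And>f. \<not> spread n m (Suc q) f" and f: "spread n m' q f" and q: "q > 0" and m: "m \<le> m'"
    and y: "y \<in> topspace Y" "y' \<in> topspace Y" "code m y = code m y'" "code m' y \<noteq> code m' y'"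
  shows "\<exists>x x' s. x \<in> topspace X \<and> x' \<in> topspace X \<and> code m (\<alpha> x) = code m (\<alpha> x') \<and>
    code m' (\<alpha> x) \<noteq> code m' (\<alpha> x') \<and> xiter s x \<in> base n \<and> xiter s x' \<in> base n"
proof -
  obtain g where g: "spread n m' q g" "\<alpha> (g 0) = y" using spread_over[OF f q y(1)] by blast
  obtain x' where x': "x' \<in> topspace X" "\<alpha> x' = y'" using \<alpha>_surj[OF y(2)] by blast
  note gm = spread_mono[OF g(1) le_refl m]
  have gX: "g a \<in> topspace X" if "a < q" for a using g(1) that unfolding spread_def by blast
  have code_g: "code m (\<alpha> (g a)) = code m y" "code m' (\<alpha> (g a)) = code m' y" if "a < q" for a
  proof -
    have "code m (\<alpha> (g a)) = code m (\<alpha> (g 0))" using gm that q unfolding spread_def by blast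
    then show "code m (\<alpha> (g a)) = code m y" using g(2) by simp
    have "code m' (\<alpha> (g a)) = code m' (\<alpha> (g 0))" using g(1) that q unfolding spread_def by blast
    then show "code m' (\<alpha> (g a)) = code m' y" using g(2) by simp
  qed
  have "\<exists>a<q. \<not> no_common_cut n (g a) x'"
  proof (rule ccontr)
    assume "\<not> ?thesis"
    then have nc: "no_common_cut n (g a) x'" if "a < q" for a using that by blast
    then have nc': "no_common_cut n x' (g a)" if "a < q" for a using that unfolding no_common_cut_def by blast
    let ?g = "g(q := x')"
    have code_x': "code m (\<alpha> (?g a)) = code m y" if "a < Suc q" for a
      using that code_g(1) x'(2) y(3) by (cases "a = q") simp_all
    have "no_common_cut n (?g a) (?g b)" if "a < Suc q" "b < Suc q" "a \<noteq> b" for a b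
    proof (cases "a = q \<or> b = q")
      case True
      then show ?thesis using that nc nc' by auto
    next
      case False
      then have "a < q" "b < q" using that by auto
      then have "no_common_cut n (g a) (g b)" using gm that(3) unfolding spread_def by blast
      then show ?thesis using False by simp
    qed
    moreover have "?g a \<in> topspace X" if "a < Suc q" for a
      using that gX x'(1) by (cases "a = q") simp_all
    ultimately have "spread n m (Suc q) ?g"
      unfolding spread_def using code_x' by (intro conjI allI impI) simp_all
    then show False using max by blast
  qed
  then obtain a s where a: "a < q" "xiter s (g a) \<in> base n" "xiter s x' \<in> base n"
    unfolding no_common_cut_def by blast
  have "code m (\<alpha> (g a)) = code m (\<alpha> x')" "code m' (\<alpha> (g a)) \<noteq> code m' (\<alpha> x')"
    using code_g[OF a(1)] x'(2) y(3,4) by simp_all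
  then show ?thesis using gX[OF a(1)] x'(1) a(2,3) by blast
qed

lemma injective_code_if_aperiodic:
  assumes aper: "\<And>p y. p > 0 \<Longrightarrow> y \<in> topspace Y \<Longrightarrow> \<exists>t. code m0 y t \<noteq> code m0 y (t + p)"
  shows "\<exists>m. \<forall>y\<in>topspace Y. \<forall>y'\<in>topspace Y. code m y = code m y' \<longrightarrow> y = y'"
proof (rule ccontr)
  assume "\<not> ?thesis"
  then have noninj: "\<exists>y y'. y \<in> topspace Y \<and> y' \<in> topspace Y \<and> code m y = code m y' \<and> y \<noteq> y'" for m
    by blast
  define L where "L = K * (2 * (2 ^ K + 1)) + 1"
  \<comment> \<open>A family for \<open>m\<close> is also one for the aperiodic level
    \<open>m0\<close>, and it stays one when \<open>n\<close> is raised until the tower words of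
    \<open>m0\<close> are determined.\<close>
  have bounded: "\<not> spread n m L f" if "m0 \<le> m" for n m f
  proof
    assume f: "spread n m L f"
    obtain n0 where n0: "\<forall>n\<ge>n0. determined n m0" using eventually_determined by blast
    have "spread (max n n0) m0 L f" using spread_mono[OF f _ that] by simp
    then obtain p where p: "p > 0" "\<forall>t. code m0 (\<alpha> (f 0)) t = code m0 (\<alpha> (f 0)) (t + p)"
      using spread_bounded[OF _ _ L_def le_refl] n0 by (metis max.cobounded2)
    have "f 0 \<in> topspace X" using f unfolding spread_def L_def by simp
    from aper[OF p(1) \<alpha>_in[OF this]] show False using p(2) by metis
  qed
  \<comment> \<open>The size must occur at every \<open>m\<close>, because each step below needs a
    family at a new and finer \<open>m'\<close>; the stage \<open>n\<close> may depend on
    \<open>m\<close>.\<close>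
  define attained where "attained q \<longleftrightarrow> (\<forall>m\<ge>m0. \<exists>n f. spread n m q f)" for q
  obtain x0 where "x0 \<in> topspace X" using nonempty_X by blast
  then have att1: "attained 1" unfolding attained_def using spread_one by blast
  have "\<exists>q>0. attained q \<and> \<not> attained (Suc q)"
  proof (rule ccontr)
    assume "\<not> ?thesis"
    then have step: "attained (Suc q)" if "q > 0" "attained q" for q using that by blast
    have "attained (Suc q)" for q by (induction q) (use att1 step in auto)
    then have "attained L" unfolding L_def by simp
    then show False using bounded unfolding attained_def by blast
  qed
  then obtain q where q: "q > 0" "attained q" "\<not> attained (Suc q)" by blast
  then obtain m1 where m1: "m0 \<le> m1" "\<And>n f. \<not> spread n m1 (Suc q) f" unfolding attained_def by blast
  have max: "\<not> spread n m (Suc q) f" if "m1 \<le> m" for n m f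
    using m1(2) spread_mono[OF _ le_refl that] by blast
  \<comment> \<open>Lower bounds for the rank: \<open>m\<close> grows with \<open>j\<close>, and the
    claim covers all large \<open>n\<close> because each later step has to enlarge
    \<open>n\<close>.\<close>
  have "\<exists>m\<ge>m1. \<exists>n0. \<forall>n\<ge>n0. \<not> rank_le (words n m) j" for j
  proof (induction j)
    case 0
    have "\<not> rank_le (words n m1) 0" for n
      using words_nonempty[of n m1] Nil_notin_words[of n m1] not_rank_le_0 by (metis equals0I)
    then show ?case by blast
  next
    case (Suc j)
    then obtain m n0 where m: "m1 \<le> m" "\<forall>n\<ge>n0. \<not> rank_le (words n m) j" by blast
    obtain y y' where y: "y \<in> topspace Y" "y' \<in> topspace Y" "code m y = code m y'" "y \<noteq> y'"
      using noninj by blast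
    obtain m' where m': "code m' y \<noteq> code m' y'" using code_separates[OF y(1,2,4)] by blast
    have le: "m \<le> m'" using code_eq_mono[OF y(3), of m'] m' by linarith
    obtain n1 f where f: "spread n1 m' q f" using q(2) le m(1) m1(1) unfolding attained_def by (meson le_trans)
    \<comment> \<open>\<open>n \<ge> n1\<close> keeps the family \<open>f\<close> spread at stage
      \<open>n\<close>, and \<open>n \<ge> n0\<close> makes the induction hypothesis available at
      the same stage.\<close>
    have "\<not> rank_le (words n m') (Suc j)" if n: "max n0 n1 \<le> n" for n
    proof
      assume rank: "rank_le (words n m') (Suc j)"
      have fn: "spread n m' q f" using spread_mono[OF f _ le_refl] n by simp
      obtain x x' s where x: "x \<in> topspace X" "x' \<in> topspace X" "code m (\<alpha> x) = code m (\<alpha> x')"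
        "code m' (\<alpha> x) \<noteq> code m' (\<alpha> x')" "xiter s x \<in> base n" "xiter s x' \<in> base n"
        using common_cut[OF max[OF m(1)] fn q(1) le y(1-3) m'] by blast
      have "(\<lambda>A. A \<inter> {..<m}) \<circ> code m' (\<alpha> x) = (\<lambda>A. A \<inter> {..<m}) \<circ> code m' (\<alpha> x')"
        using x(3) code_restrict[OF le] by simp
      then have "rank_le (map (\<lambda>A. A \<inter> {..<m}) ` words n m') j"
        using rank_drop[OF Nil_notin_words rank parses_right[OF x(1,5)] parses_left[OF x(1,5)]
            parses_right[OF x(2,6)] parses_left[OF x(2,6)] x(4)] by blast
      then show False using words_restrict[OF le] m(2) n by simp
    qed
    then show ?case using m(1) le by (meson le_trans)
  qed
  then obtain m n0 where m: "\<forall>n\<ge>n0. \<not> rank_le (words n m) K" by blast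
  obtain n1 where "\<forall>n\<ge>n1. determined n m" using eventually_determined by blast
  then have "rank_le (words (max n0 n1) m) K" by (intro rank_le_words) simp
  then show False using m by simp
qed

end

theorem corollary1p2:
  fixes X :: "'a topology" and T :: "'a \<Rightarrow> 'a"
    and Y :: "'b topology" and S :: "'b \<Rightarrow> 'b"
  assumes "essentially_minimal X T"
    and "totally_disconnected_space X"
    and "finite_topological_rank X T"
    and "minimal_cantor_factor X T Y S"
  shows "odometer Y S \<or>
    (\<exists>(A :: nat set) Z. subshift A Z \<and>
       conjugate_systems Y S (subtopology (full_shift A) Z) shift_map)"
proof -
  have X: "topspace X \<noteq> {}" "compact_space X" "homeomorphic_map X X T"
    using assms(1) unfolding essentially_minimal_def dynamical_system_def by blast+
  have cantor: "cantor_space Y" and minimal: "minimal_system Y S"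
    using assms(4) unfolding minimal_cantor_factor_def by blast+
  obtain \<alpha> where \<alpha>: "continuous_map X Y \<alpha>" "\<And>x. x \<in> topspace X \<Longrightarrow> \<alpha> (T x) = S (\<alpha> x)"
    using assms(4) unfolding minimal_cantor_factor_def factor_system_def by blast
  obtain k B h K where kr: "kr_realization X T k B h" "\<And>n. k n \<le> K"
    using assms(3) unfolding finite_topological_rank_def by blast
  have Y: "compact_space Y" "metrizable_space Y" "totally_disconnected_space Y"
    using cantor unfolding cantor_space_def by blast+
  show ?thesis
  proof (rule separating_clopen_sequence[OF Y])
    fix G :: "nat \<Rightarrow> 'b set"
    assume G: "\<And>i. clopen_pred Y (\<lambda>y. y \<in> G i)"
      "\<And>y y'. y \<in> topspace Y \<Longrightarrow> y' \<in> topspace Y \<Longrightarrow> y \<noteq> y' \<Longrightarrow> \<exists>i. y \<in> G i \<longleftrightarrow> y' \<notin> G i"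
    interpret kr_factor Y S G X T \<alpha> k B h K
      by unfold_locales (fact minimal G X \<alpha> kr)+
    show ?thesis
    \<comment> \<open>One point with a periodic code for each \<open>m\<close> suffices for an
      odometer; the negation provides a level \<open>m0\<close> at which no point has a periodic
      code.\<close>
    proof (cases "\<forall>m. \<exists>p>0. \<exists>y\<in>topspace Y. \<forall>t. code m y t = code m y (t + p)")
      case True
      have "odometer Y S" by (rule odometerI[OF cantor]) (rule spec[OF True])
      then show ?thesis ..
    next
      case False
      then obtain m0 where m0: "\<not> (\<exists>p>0. \<exists>y\<in>topspace Y. \<forall>t. code m0 y t = code m0 y (t + p))"
        unfolding not_all ..
      have "\<exists>t. code m0 y t \<noteq> code m0 y (t + p)" if "p > 0" "y \<in> topspace Y" for p y
        using m0 that by blast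
      from injective_code_if_aperiodic[OF this] obtain m where
        "\<forall>y\<in>topspace Y. \<forall>y'\<in>topspace Y. code m y = code m y' \<longrightarrow> y = y'" ..
      then have "\<exists>(A :: nat set) Z. subshift A Z \<and>
          conjugate_systems Y S (subtopology (full_shift A) Z) shift_map"
        by (intro conjugate_to_subshift[of m]) blast
      then show ?thesis ..
    qed
  qed
qed

end
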